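(* For $1\le k\le n$ let $p(n,k)$ be the number of separable permutations $\pi$ of $\{1,\dots,n\}$ with $\mathsf{iar}(\pi)=k$. Then $p(1,1)=1$, and $$p(n,1)=\sum_{j=1}^{n-1}2^{j-1}\,p(n-1,j)\quad\text{for } n\ge 2,$$ $$p(n,k)=p(n-1,k-1)+\sum_{j=k}^{n-1}2^{j-k}\,p(n-1,j)\quad\text{for } 2\le k\le n$$ (empty sums are $0$). Consequently, for all $1\le k\le n$, $$r(n-1,k-1)=p(n,k),$$ where $r(m,l)$ is the number of Schröder paths of length $2m$ with exactly $l$ hills.
   Context: Permutations of $[n]=\{1,\dots,n\}$ are written in one-line notation $\pi=\pi_1\pi_2\cdots\pi_n\in\mathfrak{S}_n$. A permutation is separable if it contains no subsequence of four entries with the same pairwise comparisons (order-isomorphic to) $2413$ or $3142$; the set of separable permutations of $[n]$ is $\mathfrak{S}_n(2413,3142)$. The initial ascending run statistic $\mathsf{iar}(\pi)$ is the greatest integer $i$, $1\le i\le n$, such that $\pi_1<\pi_2<\cdots<\pi_i$. A Schröder path of length $2m$ is a lattice path from $(0,0)$ to $(2m,0)$ consisting of up steps $U:(x,y)\to(x+1,y+1)$, down steps $D:(x,y)\to(x+1,y-1)$ and horizontal steps $H:(x,y)\to(x+2,y)$, that never goes below the $x$-axis (the empty path being the only one of length $0$). A hill is an up step immediately followed by a down step where the up step starts on the $x$-axis. $r(m,l)$ is the number of Schröder paths of length $2m$ with exactly $l$ hills, $0\le l\le m$; $r(0,0)=1$. *)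

theory Defs
  imports Main "HOL-Combinatorics.Multiset_Permutations" "HOL-Library.Sublist"
    "HOL-Library.Product_Plus"
begin

text \<open>A permutation of \<open>{1..n}\<close> in one-line notation is an element of
  \<^term>\<open>permutations_of_set {1..n}\<close>, i.e. a list without repetitions whose entries are
  exactly \<open>1, \<dots>, n\<close>. List positions are 0-based, whereas entries start at 1.\<close>

definition order_isomorphic :: "nat list \<Rightarrow> nat list \<Rightarrow> bool" where
  "order_isomorphic xs ys \<longleftrightarrow> length xs = length ys \<and>
     (\<forall>i < length xs. \<forall>j < length xs. xs ! i < xs ! j \<longleftrightarrow> ys ! i < ys ! j)"

definition contains_pattern :: "nat list \<Rightarrow> nat list \<Rightarrow> bool" where
  "contains_pattern xs pat \<longleftrightarrow> (\<exists>ys. subseq ys xs \<and> order_isomorphic ys pat)"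

definition separable_permutations :: "nat \<Rightarrow> nat list set" where
  "separable_permutations n = {xs \<in> permutations_of_set {1..n}.
     \<not> contains_pattern xs [2, 4, 1, 3] \<and> \<not> contains_pattern xs [3, 1, 4, 2]}"

text \<open>Only meaningful for nonempty lists: otherwise the set is empty and its maximum unspecified.\<close>
definition iar :: "nat list \<Rightarrow> nat" where
  "iar xs = Max {i. 1 \<le> i \<and> i \<le> length xs \<and> sorted_wrt (<) (take i xs)}"

definition p :: "nat \<Rightarrow> nat \<Rightarrow> nat" where
  "p n k = card {xs \<in> separable_permutations n. iar xs = k}"

datatype step = Up | Down | Horizontal

fun step_vector :: "step \<Rightarrow> int \<times> int" where
  "step_vector Up = (1, 1)"
| "step_vector Down = (1, -1)"
| "step_vector Horizontal = (2, 0)"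

definition endpoint :: "step list \<Rightarrow> int \<times> int" where
  "endpoint w = sum_list (map step_vector w)"

definition schroeder_paths :: "nat \<Rightarrow> step list set" where
  "schroeder_paths m = {w. endpoint w = (2 * int m, 0) \<and>
     (\<forall>i \<le> length w. 0 \<le> snd (endpoint (take i w)))}"

definition hills :: "step list \<Rightarrow> nat" where
  "hills w = card {i. Suc i < length w \<and> w ! i = Up \<and> w ! Suc i = Down \<and>
     snd (endpoint (take i w)) = 0}"

definition r :: "nat \<Rightarrow> nat \<Rightarrow> nat" where
  "r m l = card {w \<in> schroeder_paths m. hills w = l}"

end

theory Submission
  imports Defs "HOL-Computational_Algebra.Formal_Power_Series"
begin

text \<open>A separable permutation of size at least 2 is either a direct sum or a skew sum of two smaller
  ones, but not both. So a separable permutation that does not start with 1 is uniquely of the form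
  \<open>\<alpha> \<oplus> \<beta>\<close> with \<open>\<alpha>\<close> skew decomposable or \<open>\<alpha> \<ominus> \<beta>\<close> with \<open>\<alpha>\<close> skew indecomposable; in both cases its
  initial ascending run is that of \<open>\<alpha>\<close>, and \<open>(\<alpha>, \<beta>)\<close> is an arbitrary pair of nonempty separable
  permutations. Decomposing a Schroeder path at its first return to the axis gives the same
  convolution recurrence for \<open>r\<close>, whence \<open>p (n + 1) (k + 1) = r n k\<close>.

  In terms of generating functions, \<open>R\<^sub>l = X\<^sup>l / (1 - X B)\<^sup>l\<^sup>+\<^sup>1\<close> for the paths with \<open>l\<close> hills, where
  \<open>B = 1 + X B + X B\<^sup>2\<close> counts all paths. This implies \<open>R\<^sub>l + X R\<^sub>l = 2 R\<^sub>l\<^sub>+\<^sub>1 + X R\<^sub>l\<^sub>-\<^sub>1\<close>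
  (with \<open>1\<close> for the last term if \<open>l = 0\<close>), which telescopes
  into the recurrence with weights \<open>2\<^sup>j\<^sup>-\<^sup>k\<close>.\<close>

section \<open>Decomposition of separable permutations\<close>

text \<open>Taken with respect to \<open>(>)\<close>, this is avoidance of the pattern 3142. The same duality turns
  sum decomposability into skew decomposability.\<close>

definition avoids_2413 :: "('a \<Rightarrow> 'a \<Rightarrow> bool) \<Rightarrow> 'a list \<Rightarrow> bool" where
  "avoids_2413 lt xs \<longleftrightarrow> \<not> (\<exists>a b c d. subseq [a, b, c, d] xs \<and> lt c a \<and> lt a d \<and> lt d b)"

definition sum_decomposable :: "('a \<Rightarrow> 'a \<Rightarrow> bool) \<Rightarrow> 'a list \<Rightarrow> bool" where
  "sum_decomposable lt xs \<longleftrightarrow>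
     (\<exists>as bs. xs = as @ bs \<and> as \<noteq> [] \<and> bs \<noteq> [] \<and> (\<forall>a\<in>set as. \<forall>b\<in>set bs. lt a b))"

definition separable_arrangements :: "nat set \<Rightarrow> nat list set" where
  "separable_arrangements V =
     {xs \<in> permutations_of_set V. avoids_2413 (<) xs \<and> avoids_2413 (>) xs}"

text \<open>Sorted by value, the entries of 2413 stand in positions 3, 1, 4, 2. The three
  comparisons between neighbours in this order imply all the others.\<close>

lemma order_isomorphic_2413:
  "order_isomorphic ys [2, 4, 1, 3] \<longleftrightarrow>
     (\<exists>a b c d. ys = [a, b, c, d] \<and> c < a \<and> a < d \<and> d < b)"
proof
  assume iso: "order_isomorphic ys [2, 4, 1, 3]"
  then have len: "length ys = Suc (Suc (Suc (Suc 0)))"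
    by (simp add: order_isomorphic_def)
  then obtain a b c d where ys: "ys = [a, b, c, d]"
    by (auto simp: length_Suc_conv)
  have cmp: "ys ! i < ys ! j \<longleftrightarrow> [2, 4, 1, 3::nat] ! i < [2, 4, 1, 3] ! j" if "i < 4" "j < 4" for i j
    using iso that by (simp add: order_isomorphic_def ys)
  show "\<exists>a b c d. ys = [a, b, c, d] \<and> c < a \<and> a < d \<and> d < b"
    using cmp[of 2 0] cmp[of 0 3] cmp[of 3 1] by (simp add: ys)
next
  assume "\<exists>a b c d. ys = [a, b, c, d] \<and> c < a \<and> a < d \<and> d < b"
  then show "order_isomorphic ys [2, 4, 1, 3]"
    by (elim exE conjE) (simp add: order_isomorphic_def All_less_Suc2)
qed

lemma order_isomorphic_3142:
  "order_isomorphic ys [3, 1, 4, 2] \<longleftrightarrow>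
     (\<exists>a b c d. ys = [a, b, c, d] \<and> c > a \<and> a > d \<and> d > b)"
proof
  assume iso: "order_isomorphic ys [3, 1, 4, 2]"
  then have len: "length ys = Suc (Suc (Suc (Suc 0)))"
    by (simp add: order_isomorphic_def)
  then obtain a b c d where ys: "ys = [a, b, c, d]"
    by (auto simp: length_Suc_conv)
  have cmp: "ys ! i < ys ! j \<longleftrightarrow> [3, 1, 4, 2::nat] ! i < [3, 1, 4, 2] ! j" if "i < 4" "j < 4" for i j
    using iso that by (simp add: order_isomorphic_def ys)
  show "\<exists>a b c d. ys = [a, b, c, d] \<and> c > a \<and> a > d \<and> d > b"
    using cmp[of 0 2] cmp[of 3 0] cmp[of 1 3] by (simp add: ys)
next
  assume "\<exists>a b c d. ys = [a, b, c, d] \<and> c > a \<and> a > d \<and> d > b"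
  then show "order_isomorphic ys [3, 1, 4, 2]"
    by (elim exE conjE) (simp add: order_isomorphic_def All_less_Suc2)
qed

lemma separable_permutations_eq: "separable_permutations n = separable_arrangements {1..n}"
  unfolding separable_permutations_def separable_arrangements_def contains_pattern_def
    order_isomorphic_2413 order_isomorphic_3142 avoids_2413_def by blast

lemma avoids_2413_subseq: "avoids_2413 lt ys \<Longrightarrow> subseq xs ys \<Longrightarrow> avoids_2413 lt xs"
  unfolding avoids_2413_def by (meson subseq_order.trans)

lemma avoids_2413_map:
  assumes "avoids_2413 lt (map f xs)" "\<And>x y. lt x y \<Longrightarrow> lt (f x) (f y)"
  shows "avoids_2413 lt xs"
  unfolding avoids_2413_def
proof (intro notI, elim exE conjE)
  fix a b c d
  assume *: "subseq [a, b, c, d] xs" "lt c a" "lt a d" "lt d b"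
  have "subseq [f a, f b, f c, f d] (map f xs)"
    using subseq_map[OF *(1), of f] by simp
  with * assms show False
    unfolding avoids_2413_def by blast
qed

text \<open>In the third case the cut falls inside the occurrence. It cannot leave \<open>c\<close>
  on the left and \<open>b\<close> on the right at once, and this much suffices to refute the
  pattern.\<close>

lemma subseq_4_append:
  assumes "subseq [a, b, c, d] (xs @ ys)"
  obtains "subseq [a, b, c, d] xs" | "subseq [a, b, c, d] ys"
    | "a \<in> set xs" "d \<in> set ys" "b \<in> set xs \<or> c \<in> set ys"
      "b \<in> set xs \<union> set ys" "c \<in> set xs \<union> set ys"
proof -
  from assms obtain us vs where uv: "[a, b, c, d] = us @ vs" "subseq us xs" "subseq vs ys"
    by (auto simp: subseq_append_iff)
  then have sub: "set us \<subseteq> set xs" "set vs \<subseteq> set ys"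
    using list_emb_set[of "(=)"] by (metis subsetI)+
  have "us = [] \<or> us = [a] \<or> us = [a, b] \<or> us = [a, b, c] \<or> us = [a, b, c, d]"
    using uv(1) by (auto simp: Cons_eq_append_conv)
  then show thesis
    using uv sub that by auto
qed

text \<open>The pattern 2413 is itself neither a sum nor a skew sum. If the occurrence straddles the
  cut, \<open>lt a d\<close> excludes the skew case; in the other case \<open>b\<close> on the left
  contradicts \<open>lt d b\<close>, and \<open>c\<close> on the right contradicts
  \<open>lt c a\<close>.\<close>

lemma avoids_2413_append:
  assumes avoids: "avoids_2413 lt as" "avoids_2413 lt bs"
    and sep: "(\<forall>a\<in>set as. \<forall>b\<in>set bs. lt a b) \<or> (\<forall>a\<in>set as. \<forall>b\<in>set bs. lt b a)"
    and asym: "\<And>x y. lt x y \<Longrightarrow> \<not> lt y x"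
    and trans: "\<And>x y z. lt x y \<Longrightarrow> lt y z \<Longrightarrow> lt x z"
  shows "avoids_2413 lt (as @ bs)"
  unfolding avoids_2413_def
proof (intro notI, elim exE conjE)
  fix a b c d
  assume *: "subseq [a, b, c, d] (as @ bs)" "lt c a" "lt a d" "lt d b"
  from *(1) show False
  proof (cases rule: subseq_4_append)
    case 1
    then show False using avoids * unfolding avoids_2413_def by blast
  next
    case 2
    then show False using avoids * unfolding avoids_2413_def by blast
  next
    case 3
    then show False using sep asym trans * by (metis UnE)
  qed
qed

text \<open>A cut inside a first summand of minimal length would yield a still shorter first
  summand. This choice makes the decomposition canonical.\<close>

lemma sum_decomposable_shortest:
  assumes "sum_decomposable lt xs"
  obtains as bs where "xs = as @ bs" "as \<noteq> []" "bs \<noteq> []" "\<forall>a\<in>set as. \<forall>b\<in>set bs. lt a b"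
    "\<not> sum_decomposable lt as"
proof -
  define Q where "Q as \<longleftrightarrow> (\<exists>bs. xs = as @ bs \<and> as \<noteq> [] \<and> bs \<noteq> [] \<and>
    (\<forall>a\<in>set as. \<forall>b\<in>set bs. lt a b))" for as
  have "\<exists>as. Q as"
    using assms unfolding sum_decomposable_def Q_def by blast
  then obtain as where as: "Q as" "\<And>cs. Q cs \<Longrightarrow> length as \<le> length cs"
    using ex_has_least_nat[of Q _ length] by blast
  from as(1) obtain bs where bs: "xs = as @ bs" "as \<noteq> []" "bs \<noteq> []"
    "\<forall>a\<in>set as. \<forall>b\<in>set bs. lt a b"
    unfolding Q_def by blast
  have "\<not> sum_decomposable lt as"
  proof
    assume "sum_decomposable lt as"
    then obtain cs ds where cd: "as = cs @ ds" "cs \<noteq> []" "ds \<noteq> []"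
      "\<forall>a\<in>set cs. \<forall>b\<in>set ds. lt a b"
      unfolding sum_decomposable_def by blast
    have "Q cs"
      unfolding Q_def using cd bs by (intro exI[of _ "ds @ bs"]) auto
    then show False
      using as(2)[of cs] cd by simp
  qed
  with bs that show thesis by blast
qed

lemma sum_decomposable_shortest_right:
  assumes "sum_decomposable lt xs"
  obtains as bs where "xs = as @ bs" "as \<noteq> []" "bs \<noteq> []" "\<forall>a\<in>set as. \<forall>b\<in>set bs. lt a b"
    "\<not> sum_decomposable lt bs"
proof -
  define Q where "Q bs \<longleftrightarrow> (\<exists>as. xs = as @ bs \<and> as \<noteq> [] \<and> bs \<noteq> [] \<and>
    (\<forall>a\<in>set as. \<forall>b\<in>set bs. lt a b))" for bs
  have "\<exists>bs. Q bs"
    using assms unfolding sum_decomposable_def Q_def by blast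
  then obtain bs where bs: "Q bs" "\<And>cs. Q cs \<Longrightarrow> length bs \<le> length cs"
    using ex_has_least_nat[of Q _ length] by blast
  from bs(1) obtain as where as: "xs = as @ bs" "as \<noteq> []" "bs \<noteq> []"
    "\<forall>a\<in>set as. \<forall>b\<in>set bs. lt a b"
    unfolding Q_def by blast
  have "\<not> sum_decomposable lt bs"
  proof
    assume "sum_decomposable lt bs"
    then obtain cs ds where cd: "bs = cs @ ds" "cs \<noteq> []" "ds \<noteq> []"
      "\<forall>a\<in>set cs. \<forall>b\<in>set ds. lt a b"
      unfolding sum_decomposable_def by blast
    have "Q ds"
      unfolding Q_def using cd as by (intro exI[of _ "as @ cs"]) auto
    then show False
      using bs(2)[of ds] cd by simp
  qed
  with as that show thesis by blast
qed

text \<open>The first and the last entry always lie in different blocks, so comparing them tells the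
  two kinds of decomposition apart.\<close>

lemma not_sum_and_skew_decomposable:
  assumes "sum_decomposable lt xs" "sum_decomposable (\<lambda>x y. lt y x) xs"
    and asym: "\<And>x y. lt x y \<Longrightarrow> \<not> lt y x"
  shows False
proof -
  have "lt' (hd xs) (last xs)" if "sum_decomposable lt' xs" for lt'
    using that unfolding sum_decomposable_def by (auto simp: hd_append)
  from this[OF assms(1)] this[OF assms(2)] asym show False by blast
qed

lemma subseq_distinct: "subseq xs ys \<Longrightarrow> distinct ys \<Longrightarrow> distinct xs"
  by (simp add: subseqs_distinctD)

text \<open>Split \<open>xs = as \<oplus> bs\<close> with \<open>bs\<close> as short as possible. If \<open>x\<close> is below \<open>bs\<close>, it joins \<open>as\<close>.
  If \<open>x\<close> lies strictly between the extremes of \<open>bs = cs \<ominus> ds\<close>, then \<open>x\<close> forms a forbidden pattern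
  with one entry of each of \<open>as\<close>, \<open>cs\<close> and \<open>ds\<close>.\<close>

lemma decomposable_Cons:
  assumes asym: "\<And>x y. lt x y \<Longrightarrow> \<not> lt y x"
    and trans: "\<And>x y z. lt x y \<Longrightarrow> lt y z \<Longrightarrow> lt x z"
    and total: "\<And>x y. x \<noteq> y \<Longrightarrow> lt x y \<or> lt y x"
    and distinct: "distinct (x # xs)"
    and avoids: "avoids_2413 (\<lambda>x y. lt y x) (x # xs)"
    and ys: "\<And>ys. subseq ys xs \<Longrightarrow> 2 \<le> length ys \<Longrightarrow>
      sum_decomposable lt ys \<or> sum_decomposable (\<lambda>x y. lt y x) ys"
    and xs: "sum_decomposable lt xs"
  shows "sum_decomposable lt (x # xs) \<or> sum_decomposable (\<lambda>x y. lt y x) (x # xs)"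
proof (cases "(\<forall>y\<in>set xs. lt x y) \<or> (\<forall>y\<in>set xs. lt y x)")
  \<comment> \<open>An \<open>x\<close> below or above all of \<open>xs\<close> is a block of its
    own.\<close>
  case True
  moreover have "xs \<noteq> []" using xs by (auto simp: sum_decomposable_def)
  ultimately show ?thesis
    unfolding sum_decomposable_def
    by (metis append_Cons append_Nil empty_iff list.distinct(1) list.set(1) set_ConsD)
next
  case outer: False
  from xs obtain as bs where ab: "xs = as @ bs" "as \<noteq> []" "bs \<noteq> []"
    "\<forall>a\<in>set as. \<forall>b\<in>set bs. lt a b" "\<not> sum_decomposable lt bs"
    by (rule sum_decomposable_shortest_right)
  show ?thesis
  proof (cases "\<forall>b\<in>set bs. lt x b")
    case True
    with ab have "sum_decomposable lt (x # xs)"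
      unfolding sum_decomposable_def by (intro exI[of _ "x # as"] exI[of _ bs]) auto
    then show ?thesis ..
  next
    case False
    then obtain b where "b \<in> set bs" "\<not> lt x b"
      by blast
    with total[of b x] distinct ab(1) have b: "b \<in> set bs" "lt b x"
      by auto
    have as_less: "lt a x" if "a \<in> set as" for a
      using ab(4) b trans that by blast
    from outer obtain b' where "b' \<in> set xs" "\<not> lt b' x"
      by blast
    with total[of b' x] distinct ab(1) as_less have b': "b' \<in> set bs" "lt x b'"
      by auto
    have "b \<noteq> b'"
      using b b' asym by blast
    \<comment> \<open>The entries \<open>b\<close> and \<open>b'\<close> on either side of
      \<open>x\<close> are distinct, so \<open>bs\<close> is long enough for the hypothesis
      \<open>ys\<close>; minimality of \<open>bs\<close> leaves only the skew alternative.\<close>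
    have "2 \<le> length bs"
    proof (rule ccontr)
      assume "\<not> 2 \<le> length bs"
      with ab(3) have "length bs = 1" by (cases bs) (auto simp: not_less_eq_eq)
      with b b' \<open>b \<noteq> b'\<close> show False by (auto simp: length_Suc_conv)
    qed
    moreover have "subseq bs xs" by (simp add: ab(1) list_emb_append2)
    ultimately have "sum_decomposable (\<lambda>x y. lt y x) bs"
      using ys ab(5) by blast
    then obtain cs ds where cd: "bs = cs @ ds" "cs \<noteq> []" "ds \<noteq> []"
      "\<forall>c\<in>set cs. \<forall>d\<in>set ds. lt d c"
      unfolding sum_decomposable_def by blast
    \<comment> \<open>If \<open>b'\<close> lies in \<open>ds\<close>, every entry of
      \<open>cs\<close> exceeds it and hence \<open>x\<close>. The next claim is dual.\<close>
    have "\<exists>c\<in>set cs. lt x c"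
      using b' cd trans by (metis Un_iff last_in_set set_append)
    moreover have "\<exists>d\<in>set ds. lt d x"
      using b cd trans by (metis Un_iff last_in_set set_append)
    ultimately obtain c d where "c \<in> set cs" "lt x c" "d \<in> set ds" "lt d x"
      by blast
    obtain a where "a \<in> set as" using ab(2) by (meson last_in_set)
    have "subseq ([a] @ [c] @ [d]) (as @ cs @ ds)"
      using \<open>a \<in> set as\<close> \<open>c \<in> set cs\<close> \<open>d \<in> set ds\<close>
      by (intro list_emb_append_mono[of _ "[a]"] list_emb_append_mono[of _ "[c]"])
        (simp_all add: subseq_singleton_left)
    \<comment> \<open>In increasing order these entries are \<open>a\<close>, \<open>d\<close>,
      \<open>x\<close>, \<open>c\<close>, so they form a 3142.\<close>
    then have "subseq [x, a, c, d] (x # xs)"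
      by (simp add: ab(1) cd(1))
    moreover have "lt a d"
      using ab(4) \<open>a \<in> set as\<close> \<open>d \<in> set ds\<close> cd(1) by simp
    ultimately show ?thesis
      using avoids \<open>lt x c\<close> \<open>lt d x\<close> unfolding avoids_2413_def by blast
  qed
qed

text \<open>Induction on the length, removing the first entry. The induction hypothesis is used for
  all subsequences of the tail, since \<open>decomposable_Cons\<close> applies it to a block of the
  tail.\<close>

lemma separable_decomposable:
  fixes xs :: "'a :: linorder list"
  assumes "distinct xs" "avoids_2413 (<) xs" "avoids_2413 (>) xs" "2 \<le> length xs"
  shows "sum_decomposable (<) xs \<or> sum_decomposable (>) xs"
  using assms
proof (induction "length xs" arbitrary: xs rule: less_induct)
  case less
  then obtain x y zs where "xs = x # y # zs"
    by (auto simp: numeral_2_eq_2 Suc_le_length_iff)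
  then obtain ys where xs: "xs = x # ys" "ys \<noteq> []"
    by blast
  have IH: "sum_decomposable (<) zs \<or> sum_decomposable (>) zs"
    if "subseq zs ys" "2 \<le> length zs" for zs
  proof -
    have "subseq zs xs" using that xs by auto
    moreover have "length zs < length xs"
      using list_emb_length[OF that(1)] xs by simp
    ultimately show ?thesis
      using less.hyps[of zs] less.prems that avoids_2413_subseq subseq_distinct by blast
  qed
  show ?case
  proof (cases "2 \<le> length ys")
    case True
    with IH[of ys] consider "sum_decomposable (<) ys" | "sum_decomposable (>) ys"
      by blast
    then show ?thesis
    proof cases
      case 1
      show ?thesis
        unfolding xs(1)
        by (rule decomposable_Cons[where lt = "(<)", OF _ _ _ _ _ IH 1])
          (use less.prems xs in auto)
    next
      case 2
      \<comment> \<open>The same argument with the order reversed, so that the two kinds of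
        decomposition change places.\<close>
      have "sum_decomposable (>) (x # ys) \<or> sum_decomposable (<) (x # ys)"
        by (rule decomposable_Cons[where lt = "(>)",
              OF _ _ _ _ _ IH[unfolded disj_commute[of "sum_decomposable (<) _"]] 2])
          (use less.prems xs in auto)
      then show ?thesis
        unfolding xs(1) by blast
    qed
  next
    case False
    with xs(2) obtain y where y: "ys = [y]"
      by (cases ys) (auto simp: not_less_eq_eq)
    have pair: "sum_decomposable lt [x, y]" if "lt x y" for lt
      unfolding sum_decomposable_def using that by (intro exI[of _ "[x]"] exI[of _ "[y]"]) simp
    from less.prems xs y have "x < y \<or> y < x"
      by auto
    then show ?thesis
      unfolding xs(1) y using pair[of "(<)"] pair[of "(>)"] by (elim disjE) simp_all
  qed
qed

section \<open>Initial ascending runs\<close>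

definition ascending_prefixes :: "nat list \<Rightarrow> nat set" where
  "ascending_prefixes xs = {i. 1 \<le> i \<and> i \<le> length xs \<and> sorted_wrt (<) (take i xs)}"

lemma iar_eq_Max: "iar xs = Max (ascending_prefixes xs)"
  by (simp add: iar_def ascending_prefixes_def)

lemma finite_ascending_prefixes: "finite (ascending_prefixes xs)"
  by (rule finite_subset[of _ "{..length xs}"]) (auto simp: ascending_prefixes_def)

lemma one_in_ascending_prefixes: "xs \<noteq> [] \<Longrightarrow> 1 \<in> ascending_prefixes xs"
  by (cases xs) (auto simp: ascending_prefixes_def)

lemma iar_in_ascending_prefixes: "xs \<noteq> [] \<Longrightarrow> iar xs \<in> ascending_prefixes xs"
  unfolding iar_eq_Max using finite_ascending_prefixes one_in_ascending_prefixes
  by (metis Max_in empty_iff)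

lemma iar_bounds:
  assumes "xs \<noteq> []"
  shows "1 \<le> iar xs" "iar xs \<le> length xs"
  using iar_in_ascending_prefixes[OF assms] by (auto simp: ascending_prefixes_def)

lemma iar_shift: "iar (map ((+) c) xs) = iar xs"
  by (simp add: iar_def take_map sorted_wrt_map)

text \<open>Every prefix longer than \<open>as\<close> extends \<open>as @ [hd bs]\<close>, which is
  not ascending.\<close>

lemma iar_append:
  assumes "as \<noteq> []" "bs \<noteq> []" "\<not> sorted_wrt (<) (as @ [hd bs])"
  shows "iar (as @ bs) = iar as"
proof -
  obtain b bs' where bs: "bs = b # bs'"
    using assms(2) by (cases bs) auto
  have long: "\<not> sorted_wrt (<) (take i (as @ bs))" if "\<not> i \<le> length as" for i
  proof
    assume sorted: "sorted_wrt (<) (take i (as @ bs))"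
    from that obtain j where "i = length as + Suc j"
      by (metis add_Suc_right less_imp_Suc_add not_le)
    then have "take i (as @ bs) = (as @ [hd bs]) @ take j bs'"
      by (simp add: bs)
    with sorted assms(3) show False
      by (metis sorted_wrt_append)
  qed
  have "i \<in> ascending_prefixes (as @ bs) \<longleftrightarrow> i \<in> ascending_prefixes as" for i
    using long[of i] by (cases "i \<le> length as") (simp_all add: ascending_prefixes_def)
  then have "ascending_prefixes (as @ bs) = ascending_prefixes as"
    by blast
  then show ?thesis
    by (simp add: iar_eq_Max)
qed

text \<open>A smaller entry in front lengthens each ascending prefix by one; the only additional
  prefix is the one of length 1.\<close>

lemma iar_Cons:
  assumes "xs \<noteq> []" "\<forall>y\<in>set xs. x < y"
  shows "iar (x # xs) = Suc (iar xs)"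
proof -
  have "ascending_prefixes (x # xs) = insert 1 (Suc ` ascending_prefixes xs)"
  proof (intro set_eqI)
    fix i
    show "i \<in> ascending_prefixes (x # xs) \<longleftrightarrow> i \<in> insert 1 (Suc ` ascending_prefixes xs)"
    proof (cases i)
      case (Suc j)
      have "\<forall>y\<in>set (take j xs). x < y"
        using assms(2) by (meson in_set_takeD)
      with Suc show ?thesis
        by (auto simp: ascending_prefixes_def)
    qed (auto simp: ascending_prefixes_def)
  qed
  moreover have "Max (Suc ` ascending_prefixes xs) = Suc (iar xs)"
    unfolding iar_eq_Max
    using finite_ascending_prefixes one_in_ascending_prefixes[OF assms(1)]
    by (subst mono_Max_commute[of Suc]) (auto simp: mono_def)
  moreover have "ascending_prefixes xs \<noteq> {}"
    using one_in_ascending_prefixes[OF assms(1)] by blast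
  ultimately show ?thesis
    using finite_ascending_prefixes[of xs] by (simp add: iar_eq_Max[of "x # xs"])
qed

section \<open>Shifts and value intervals of separable blocks\<close>

lemma avoids_2413_shift:
  "avoids_2413 (<) (map ((+) c) xs) \<longleftrightarrow> avoids_2413 (<) (xs :: nat list)"
  "avoids_2413 (>) (map ((+) c) xs) \<longleftrightarrow> avoids_2413 (>) (xs :: nat list)"
proof -
  have inverse: "map (\<lambda>x. x - c) (map ((+) c) xs) = xs"
    by (simp add: o_def)
  have shift: "avoids_2413 lt (map ((+) c) ys)" if "avoids_2413 lt ys"
    "\<And>x y. lt (c + x) (c + y) = lt x y" for lt :: "nat \<Rightarrow> nat \<Rightarrow> bool" and ys
    unfolding avoids_2413_def
  proof (intro notI, elim exE conjE)
    fix a b d e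
    assume *: "subseq [a, b, d, e] (map ((+) c) ys)" "lt d a" "lt a e" "lt e b"
    then have "subseq (map (\<lambda>x. x - c) [a, b, d, e]) (map (\<lambda>x. x - c) (map ((+) c) ys))"
      using subseq_map by blast
    then have sub: "subseq [a - c, b - c, d - c, e - c] ys"
      by (simp add: o_def)
    have "set [a, b, d, e] \<subseteq> set (map ((+) c) ys)"
      using list_emb_set[OF *(1)] by (metis subsetI)
    \<comment> \<open>Entries of the shifted list are at least \<open>c\<close>, so truncated
      subtraction really undoes the shift on them.\<close>
    then have "c \<le> a" "c \<le> b" "c \<le> d" "c \<le> e"
      by auto
    then have "lt (d - c) (a - c)" "lt (a - c) (e - c)" "lt (e - c) (b - c)"
      using * that(2)[of "d - c" "a - c"] that(2)[of "a - c" "e - c"] that(2)[of "e - c" "b - c"]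
      by simp_all
    with sub that(1) show False
      unfolding avoids_2413_def by blast
  qed
  show "avoids_2413 (<) (map ((+) c) xs) \<longleftrightarrow> avoids_2413 (<) xs"
    using shift[of "(<)" xs] avoids_2413_map[of "(<)" "(+) c" xs] by auto
  show "avoids_2413 (>) (map ((+) c) xs) \<longleftrightarrow> avoids_2413 (>) xs"
    using shift[of "(>)" xs] avoids_2413_map[of "(>)" "(+) c" xs] by auto
qed

lemma skew_decomposable_shift:
  "sum_decomposable (>) (map ((+) c) xs) \<longleftrightarrow> sum_decomposable (>) (xs :: nat list)"
proof
  assume "sum_decomposable (>) (map ((+) c) xs)"
  then obtain as bs where ab: "map ((+) c) xs = as @ bs" "as \<noteq> []" "bs \<noteq> []"
    "\<forall>a\<in>set as. \<forall>b\<in>set bs. a > b"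
    unfolding sum_decomposable_def by blast
  then obtain as' bs' where "xs = as' @ bs'" "as = map ((+) c) as'" "bs = map ((+) c) bs'"
    unfolding map_eq_append_conv by blast
  with ab show "sum_decomposable (>) xs"
    unfolding sum_decomposable_def by (intro exI[of _ as'] exI[of _ bs']) auto
next
  assume "sum_decomposable (>) xs"
  then obtain as bs where ab: "xs = as @ bs" "as \<noteq> []" "bs \<noteq> []"
    "\<forall>a\<in>set as. \<forall>b\<in>set bs. a > b"
    unfolding sum_decomposable_def by blast
  then show "sum_decomposable (>) (map ((+) c) xs)"
    unfolding sum_decomposable_def
    by (intro exI[of _ "map ((+) c) as"] exI[of _ "map ((+) c) bs"]) auto
qed

lemma finite_separable_arrangements: "finite (separable_arrangements V)"
  by (simp add: separable_arrangements_def)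

lemma separable_arrangementsD:
  assumes "xs \<in> separable_arrangements V"
  shows "set xs = V" "distinct xs" "avoids_2413 (<) xs" "avoids_2413 (>) xs" "length xs = card V"
  using assms by (auto simp: separable_arrangements_def permutations_of_set_def distinct_card)

lemma separable_arrangements_shift:
  "separable_arrangements ((+) c ` V) = map ((+) c) ` separable_arrangements V"
  unfolding separable_arrangements_def
  by (subst permutations_of_set_image_inj) (auto simp: avoids_2413_shift)

text \<open>The upper block of a sum or skew sum uses an interval of values that does not start at
  1. Counting such blocks by a shift-invariant property reduces to permutations in the usual
  sense.\<close>

lemma card_separable_arrangements_shift:
  assumes "\<And>xs. Q (map ((+) c) xs) \<longleftrightarrow> Q xs"
  shows "card {xs \<in> separable_arrangements {Suc c..n + c}. Q xs} =
    card {xs \<in> separable_permutations n. Q xs}"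
proof -
  have "{Suc c..n + c} = (+) c ` {1..n}"
    by (simp add: image_add_atLeastAtMost add.commute)
  then have "separable_arrangements {Suc c..n + c} = map ((+) c) ` separable_permutations n"
    by (simp only: separable_arrangements_shift separable_permutations_eq)
  then have "{xs \<in> separable_arrangements {Suc c..n + c}. Q xs} =
      map ((+) c) ` {xs \<in> separable_permutations n. Q xs}"
    using assms by auto
  moreover have "inj_on (map ((+) c)) A" for A :: "nat list set"
    by (rule inj_on_subset[OF inj_mapI]) auto
  ultimately show ?thesis
    by (simp add: card_image)
qed

text \<open>No number below \<open>Max A\<close> can lie in \<open>B\<close>, so \<open>A\<close>
  has no gaps. Hence the sizes of two blocks determine their value sets.\<close>

lemma initial_segment_eq:
  assumes "A \<union> B = {1..n}" "\<forall>a\<in>A. \<forall>b\<in>B. a < (b::nat)"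
  shows "A = {1..card A}" "B = {Suc (card A)..n}"
proof -
  have fin: "finite A" "finite B"
    using assms(1) by (metis finite_Un finite_atLeastAtMost)+
  show A: "A = {1..card A}"
  proof (cases "A = {}")
    case False
    have "A = {1..Max A}"
    proof (intro set_eqI iffI)
      fix x assume "x \<in> A"
      then show "x \<in> {1..Max A}" using assms(1) fin by auto
    next
      fix x assume x: "x \<in> {1..Max A}"
      have "Max A \<in> A" using fin False by simp
      with assms(1) have "Max A \<le> n" by auto
      with x assms(1) have "x \<in> A \<union> B" by simp
      with x assms(2) \<open>Max A \<in> A\<close> show "x \<in> A"
        by (metis UnE atLeastAtMost_iff not_less)
    qed
    then show ?thesis by (metis card_atLeastAtMost diff_Suc_1)
  qed simp
  have "B = {1..n} - A" using assms by auto
  moreover have "{1..n} - {1..m} = {Suc m..n}" for m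
    by auto
  ultimately show "B = {Suc (card A)..n}"
    using A by metis
qed

lemma separable_arrangements_split:
  assumes "as @ bs \<in> separable_arrangements V"
  shows "as \<in> separable_arrangements (set as)" "bs \<in> separable_arrangements (set bs)"
proof -
  have "subseq as (as @ bs)" "subseq bs (as @ bs)"
    by (auto simp: subseq_append_iff)
  with separable_arrangementsD[OF assms]
  have "avoids_2413 (<) as" "avoids_2413 (>) as" "avoids_2413 (<) bs" "avoids_2413 (>) bs"
    by (blast intro: avoids_2413_subseq)+
  with separable_arrangementsD(2)[OF assms]
  show "as \<in> separable_arrangements (set as)" "bs \<in> separable_arrangements (set bs)"
    by (simp_all add: separable_arrangements_def permutations_of_set_def)
qed

lemma separable_arrangements_append:
  assumes "as \<in> separable_arrangements A" "bs \<in> separable_arrangements B"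
    and "(\<forall>a\<in>A. \<forall>b\<in>B. a < b) \<or> (\<forall>a\<in>A. \<forall>b\<in>B. a > b)"
  shows "as @ bs \<in> separable_arrangements (A \<union> B)"
proof -
  note D = separable_arrangementsD[OF assms(1)] separable_arrangementsD[OF assms(2)]
  have "A \<inter> B = {}" using assms(3) less_asym by blast
  moreover have "avoids_2413 (<) (as @ bs)"
    by (rule avoids_2413_append) (use D assms(3) in simp_all)
  moreover have "(\<forall>a\<in>A. \<forall>b\<in>B. a > b) \<or> (\<forall>a\<in>A. \<forall>b\<in>B. b > a)"
    using assms(3) by blast
  then have "avoids_2413 (>) (as @ bs)"
    by (intro avoids_2413_append) (use D in simp_all)
  ultimately show ?thesis
    using D by (simp add: separable_arrangements_def permutations_of_set_def)
qed

section \<open>Initial ascending runs of sums and skew sums\<close>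

lemma skew_decomposable_not_sorted:
  assumes "sum_decomposable (>) (xs :: nat list)"
  shows "\<not> sorted_wrt (<) xs"
proof
  assume sorted: "sorted_wrt (<) xs"
  from assms obtain as bs where "xs = as @ bs" "as \<noteq> []" "bs \<noteq> []"
    "\<forall>a\<in>set as. \<forall>b\<in>set bs. a > b"
    unfolding sum_decomposable_def by blast
  with sorted have "hd as < hd bs" "hd as > hd bs"
    by (auto simp: sorted_wrt_append)
  then show False by simp
qed

text \<open>The run already ends inside \<open>as\<close>, since a skew decomposable list is not
  ascending; the values of \<open>bs\<close> do not matter.\<close>

lemma iar_skew_decomposable_append:
  assumes "sum_decomposable (>) (as :: nat list)" "bs \<noteq> []"
  shows "iar (as @ bs) = iar as"
proof (rule iar_append)
  show "as \<noteq> []" using assms(1) by (auto simp: sum_decomposable_def)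
  show "\<not> sorted_wrt (<) (as @ [hd bs])"
    using skew_decomposable_not_sorted[OF assms(1)] by (simp add: sorted_wrt_append)
qed fact

lemma iar_skew_append:
  assumes "as \<noteq> []" "bs \<noteq> []" "\<forall>a\<in>set as. \<forall>b\<in>set bs. (a :: nat) > b"
  shows "iar (as @ bs) = iar as"
proof (rule iar_append)
  have "hd as > hd bs" using assms by simp
  then show "\<not> sorted_wrt (<) (as @ [hd bs])"
    using assms(1) by (cases as) (auto simp: sorted_wrt_append)
qed (use assms in simp_all)

lemma skew_decomposable_hd:
  assumes "sum_decomposable (>) (xs :: nat list)"
  shows "\<exists>y\<in>set xs. y < hd xs"
proof -
  from assms obtain as bs where "xs = as @ bs" "as \<noteq> []" "bs \<noteq> []"
    "\<forall>a\<in>set as. \<forall>b\<in>set bs. a > b"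
    unfolding sum_decomposable_def by blast
  then show ?thesis
    by (intro bexI[of _ "hd bs"]) simp_all
qed

text \<open>The pairs \<open>(as, bs)\<close> encode the arrangements not starting with 1: the first block is split
  off the direct sum if it is skew decomposable, and off the skew sum if it is not.\<close>

definition first_block_pairs :: "nat \<Rightarrow> nat \<Rightarrow> (nat list \<times> nat list) set" where
  "first_block_pairs n k = {(as, bs). as \<noteq> [] \<and> bs \<noteq> [] \<and>
     as @ bs \<in> separable_arrangements {1..n} \<and> iar as = k \<and>
     (if sum_decomposable (>) as then \<forall>a\<in>set as. \<forall>b\<in>set bs. a < b
      else \<forall>a\<in>set as. \<forall>b\<in>set bs. a > b)}"

lemma first_block_pairsI:
  assumes "as \<noteq> []" "bs \<noteq> []" "as @ bs \<in> separable_arrangements {1..n}" "iar as = k"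
    and "if sum_decomposable (>) as then \<forall>a\<in>set as. \<forall>b\<in>set bs. a < b
      else \<forall>a\<in>set as. \<forall>b\<in>set bs. a > b"
  shows "(as, bs) \<in> first_block_pairs n k"
  unfolding first_block_pairs_def by (intro CollectI case_prodI conjI assms)

lemma first_block_pairsD:
  assumes "(as, bs) \<in> first_block_pairs n k"
  shows "as \<noteq> []" "bs \<noteq> []" "as @ bs \<in> separable_arrangements {1..n}" "iar as = k"
    and "sum_decomposable (>) as \<Longrightarrow> \<forall>a\<in>set as. \<forall>b\<in>set bs. a < b"
    and "\<not> sum_decomposable (>) as \<Longrightarrow> \<forall>a\<in>set as. \<forall>b\<in>set bs. a > b"
proof -
  from assms have *: "as \<noteq> [] \<and> bs \<noteq> [] \<and> as @ bs \<in> separable_arrangements {1..n} \<and> iar as = k \<and>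
     (if sum_decomposable (>) as then \<forall>a\<in>set as. \<forall>b\<in>set bs. a < b
      else \<forall>a\<in>set as. \<forall>b\<in>set bs. a > b)"
    unfolding first_block_pairs_def by (elim CollectE case_prodE Pair_inject) blast
  from * show "as \<noteq> []" "bs \<noteq> []" "as @ bs \<in> separable_arrangements {1..n}" "iar as = k"
    by blast+
  show "\<forall>a\<in>set as. \<forall>b\<in>set bs. a < b" if "sum_decomposable (>) as"
    using * that by argo
  show "\<forall>a\<in>set as. \<forall>b\<in>set bs. a > b" if "\<not> sum_decomposable (>) as"
    using * that by argo
qed

section \<open>Existence and uniqueness of the first block\<close>

lemma sum_decomposable_append:
  "as \<noteq> [] \<Longrightarrow> bs \<noteq> [] \<Longrightarrow> \<forall>a\<in>set as. \<forall>b\<in>set bs. lt a b \<Longrightarrow> sum_decomposable lt (as @ bs)"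
  unfolding sum_decomposable_def by (intro exI[of _ as] exI[of _ bs]) simp

text \<open>If \<open>as\<close> is skew decomposable, then \<open>cs\<close> is a sum, hence not
  skew decomposable, so the whole list is a skew sum at \<open>cs\<close> and a sum at
  \<open>as\<close>. Otherwise \<open>cs\<close> is a skew sum and so lies below \<open>ds\<close>,
  although its part \<open>as\<close> lies above \<open>ds\<close>.\<close>

lemma first_block_unique_aux:
  assumes "(as, bs) \<in> first_block_pairs n k" "(cs, ds) \<in> first_block_pairs n k"
    "as @ bs = cs @ ds" "length as < length cs"
  shows False
proof -
  from assms(3,4) obtain es where es: "cs = as @ es" "bs = es @ ds" "es \<noteq> []"
    by (auto simp: append_eq_append_conv2)
  note ab = first_block_pairsD[OF assms(1)] and cd = first_block_pairsD[OF assms(2)]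
  show False
  proof (cases "sum_decomposable (>) as")
    case True
    then have less: "\<forall>a\<in>set as. \<forall>b\<in>set bs. a < b" by (rule ab)
    have "sum_decomposable (<) cs"
      unfolding es(1) using ab(1) es(3) less es(2) by (intro sum_decomposable_append) simp_all
    then have "\<not> sum_decomposable (>) cs"
      using not_sum_and_skew_decomposable[of "(<)" cs] by auto
    with cd(1,2) cd(6) have "sum_decomposable (>) (cs @ ds)"
      by (intro sum_decomposable_append)
    moreover have "sum_decomposable (<) (cs @ ds)"
      unfolding assms(3)[symmetric] using ab(1,2) less by (rule sum_decomposable_append)
    ultimately show False
      using not_sum_and_skew_decomposable[of "(<)" "cs @ ds"] by auto
  next
    case False
    then have skew: "\<forall>a\<in>set as. \<forall>b\<in>set bs. b < a" by (rule ab)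
    have "sum_decomposable (>) cs"
      unfolding es(1) using ab(1) es(3) skew es(2) by (intro sum_decomposable_append) simp_all
    then have "\<forall>a\<in>set cs. \<forall>b\<in>set ds. a < b"
      by (rule cd)
    then have "hd as < hd ds"
      using ab(1) cd(2) es(1) by simp
    moreover have "hd ds < hd as"
      using skew ab(1) cd(2) es(2) by simp
    ultimately show False by simp
  qed
qed

lemma inj_on_append_first_block_pairs:
  "inj_on (\<lambda>(as, bs). as @ bs) (first_block_pairs n k)"
proof (intro inj_onI, clarify)
  fix as bs cs ds :: "nat list"
  assume *: "(as, bs) \<in> first_block_pairs n k" "(cs, ds) \<in> first_block_pairs n k"
    "as @ bs = cs @ ds"
  have "length as = length cs"
    using first_block_unique_aux[OF *] first_block_unique_aux[OF *(2,1) *(3)[symmetric]]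
    by (cases "length as" "length cs" rule: linorder_cases) simp_all
  then show "as = cs \<and> bs = ds"
    using *(3) by simp
qed

lemma append_image_first_block_pairs:
  "(\<lambda>(as, bs). as @ bs) ` first_block_pairs n k =
     {xs \<in> separable_permutations n. iar xs = k \<and> hd xs \<noteq> 1}" if n: "1 \<le> n"
proof (intro equalityI subsetI)
  fix xs assume "xs \<in> (\<lambda>(as, bs). as @ bs) ` first_block_pairs n k"
  then obtain as bs where xs: "xs = as @ bs" and ab: "(as, bs) \<in> first_block_pairs n k"
    by auto
  note * = first_block_pairsD[OF ab]
  have pos: "1 \<le> y" if "y \<in> set xs" for y
    using separable_arrangementsD(1)[OF *(3)] that xs by auto
  \<comment> \<open>In both cases some entry is smaller than the first one, which therefore is not
    1.\<close>
  have "\<exists>y\<in>set xs. y < hd xs" if "sum_decomposable (>) as"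
    using skew_decomposable_hd[OF that] *(1) xs by auto
  moreover have "\<exists>y\<in>set xs. y < hd xs" if "\<not> sum_decomposable (>) as"
    using *(1,2) *(6)[OF that] xs by (intro bexI[of _ "hd bs"]) simp_all
  ultimately have "hd xs \<noteq> 1"
    using pos by (metis not_le)
  moreover have "iar xs = k"
    using * iar_skew_decomposable_append[of as bs] iar_skew_append[of as bs] xs
    by (cases "sum_decomposable (>) as") simp_all
  ultimately show "xs \<in> {xs \<in> separable_permutations n. iar xs = k \<and> hd xs \<noteq> 1}"
    using *(3) xs by (simp add: separable_permutations_eq)
next
  fix xs assume "xs \<in> {xs \<in> separable_permutations n. iar xs = k \<and> hd xs \<noteq> 1}"
  then have xs: "xs \<in> separable_arrangements {1..n}" "iar xs = k" "hd xs \<noteq> 1"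
    by (auto simp: separable_permutations_eq)
  note D = separable_arrangementsD[OF xs(1)]
  have "xs \<noteq> []" using D n by auto
  then have hd: "1 < hd xs"
    using D(1) xs(3) hd_in_set[of xs] by (cases "hd xs") auto
  moreover have "1 \<in> set xs" using D(1) n by simp
  ultimately have "length xs \<noteq> 1"
    by (auto simp: length_Suc_conv)
  with \<open>xs \<noteq> []\<close> have len: "2 \<le> length xs"
    by (cases xs) (auto simp: Suc_le_eq)
  show "xs \<in> (\<lambda>(as, bs). as @ bs) ` first_block_pairs n k"
  proof (cases "sum_decomposable (>) xs")
    case True
    then obtain as bs where ab: "xs = as @ bs" "as \<noteq> []" "bs \<noteq> []"
      "\<forall>a\<in>set as. \<forall>b\<in>set bs. a > b" "\<not> sum_decomposable (>) as"
      by (rule sum_decomposable_shortest)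
    then have "iar as = k"
      using iar_skew_append[of as bs] xs(2) by simp
    with ab xs(1) have "(as, bs) \<in> first_block_pairs n k"
      by (intro first_block_pairsI) simp_all
    with ab(1) show ?thesis by force
  next
    case False
    with separable_decomposable D len have "sum_decomposable (<) xs"
      by blast
    then obtain as bs where ab: "xs = as @ bs" "as \<noteq> []" "bs \<noteq> []"
      "\<forall>a\<in>set as. \<forall>b\<in>set bs. a < b" "\<not> sum_decomposable (<) as"
      by (rule sum_decomposable_shortest)
    \<comment> \<open>A first summand of one entry would make the first entry the minimum 1. With
      two entries or more, the sum indecomposable \<open>as\<close> has to be skew
      decomposable.\<close>
    have "2 \<le> length as"
    proof (rule ccontr)
      assume "\<not> 2 \<le> length as"
      with ab(2) have "length as = 1" by (cases as) (auto simp: not_less_eq_eq)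
      then obtain a where "as = [a]" by (auto simp: length_Suc_conv)
      then have "hd xs \<le> y" if "y \<in> set xs" for y
        using ab(1,4) that by fastforce
      with \<open>1 \<in> set xs\<close> hd show False by fastforce
    qed
    moreover have "as \<in> separable_arrangements (set as)"
      using separable_arrangements_split(1) ab(1) xs(1) by metis
    note separable_arrangementsD[OF this]
    ultimately have skew: "sum_decomposable (>) as"
      using separable_decomposable[of as] ab(5) by blast
    then have "iar as = k"
      using iar_skew_decomposable_append[of as bs] ab xs(2) by simp
    with ab xs(1) skew have "(as, bs) \<in> first_block_pairs n k"
      by (intro first_block_pairsI) simp_all
    with ab(1) show ?thesis by force
  qed
qed

text \<open>The index \<open>i\<close> is the length of the second block. The first block takes the
  lower \<open>n-i\<close> values in a direct sum and the upper \<open>n-i\<close> values in a skew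
  sum.\<close>

lemma first_block_pairs_eq:
  "first_block_pairs n k = (\<Union>i\<in>{1..n-1}.
     {as \<in> separable_arrangements {1..n-i}. iar as = k \<and> sum_decomposable (>) as} \<times>
       separable_arrangements {Suc (n-i)..n} \<union>
     {as \<in> separable_arrangements {Suc i..n}. iar as = k \<and> \<not> sum_decomposable (>) as} \<times>
       separable_arrangements {1..i})" (is "_ = (\<Union>i\<in>_. ?D i \<union> ?E i)")
proof (intro equalityI subsetI)
  fix z assume "z \<in> first_block_pairs n k"
  then obtain as bs where z: "z = (as, bs)" and "(as, bs) \<in> first_block_pairs n k"
    by (cases z) auto
  note ab = first_block_pairsD[OF this(2)]
  define i where "i = length bs"
  note sep = ab(3)
  note D = separable_arrangementsD[OF sep]
  note S = separable_arrangements_split[OF sep]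
  have union: "set as \<union> set bs = {1..n}" "set bs \<union> set as = {1..n}" using D(1) by auto
  have len: "length as + i = n" using D(5) by (simp add: i_def)
  have card: "card (set as) = n - i" "card (set bs) = i"
    using D(2) len by (auto simp: distinct_card i_def)
  have i: "i \<in> {1..n-1}"
  proof -
    have "0 < length as" "0 < i" using ab(1,2) by (auto simp: i_def)
    with len show ?thesis unfolding atLeastAtMost_iff by linarith
  qed
  show "z \<in> (\<Union>i\<in>{1..n-1}. ?D i \<union> ?E i)"
  proof (cases "sum_decomposable (>) as")
    case True
    then have "\<forall>a\<in>set as. \<forall>b\<in>set bs. a < b" by (rule ab)
    from initial_segment_eq[OF union(1) this, unfolded card] S
    have "as \<in> separable_arrangements {1..n-i}" "bs \<in> separable_arrangements {Suc (n-i)..n}"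
      by simp_all
    with True ab(4) have "z \<in> ?D i"
      unfolding z by blast
    with i show ?thesis by blast
  next
    case False
    \<comment> \<open>Here \<open>bs\<close> is the lower block, so the roles in
      \<open>initial_segment_eq\<close> are exchanged.\<close>
    then have "\<forall>b\<in>set bs. \<forall>a\<in>set as. b < a" using ab(6) by blast
    from initial_segment_eq[OF union(2) this, unfolded card] S
    have "as \<in> separable_arrangements {Suc i..n}" "bs \<in> separable_arrangements {1..i}"
      by simp_all
    with False ab(4) have "z \<in> ?E i"
      unfolding z by blast
    with i show ?thesis by blast
  qed
next
  fix z assume "z \<in> (\<Union>i\<in>{1..n-1}. ?D i \<union> ?E i)"
  then obtain i as bs where i: "i \<in> {1..n-1}" and z: "z = (as, bs)" "(as, bs) \<in> ?D i \<union> ?E i"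
    by (cases z) blast
  from i have ne: "{1..n-i} \<noteq> {}" "{Suc (n-i)..n} \<noteq> {}" "{Suc i..n} \<noteq> {}" "{1..i} \<noteq> {}"
    by auto
  have union: "{1..n-i} \<union> {Suc (n-i)..n} = {1..n}" "{Suc i..n} \<union> {1..i} = {1..n}"
    using i by auto
  from z(2) have "(as, bs) \<in> first_block_pairs n k"
  proof (rule UnE)
    assume "(as, bs) \<in> ?D i"
    then have sets: "as \<in> separable_arrangements {1..n-i}" "bs \<in> separable_arrangements {Suc (n-i)..n}"
      and "iar as = k" "sum_decomposable (>) as"
      by simp_all
    have less: "\<forall>a\<in>{1..n-i}. \<forall>b\<in>{Suc (n-i)..n}. a < b" by auto
    have "as @ bs \<in> separable_arrangements {1..n}"
      using separable_arrangements_append[OF sets] less unfolding union by blast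
    moreover have "set as = {1..n-i}" "set bs = {Suc (n-i)..n}"
      using sets by (auto dest: separable_arrangementsD(1))
    moreover from this ne have "as \<noteq> []" "bs \<noteq> []"
      by auto
    ultimately show ?thesis
      using less \<open>iar as = k\<close> \<open>sum_decomposable (>) as\<close>
      by (intro first_block_pairsI) simp_all
  next
    assume "(as, bs) \<in> ?E i"
    then have sets: "as \<in> separable_arrangements {Suc i..n}" "bs \<in> separable_arrangements {1..i}"
      and "iar as = k" "\<not> sum_decomposable (>) as"
      by simp_all
    have less: "\<forall>a\<in>{Suc i..n}. \<forall>b\<in>{1..i}. a > b" by auto
    have "as @ bs \<in> separable_arrangements {1..n}"
      using separable_arrangements_append[OF sets] less unfolding union by blast
    moreover have "set as = {Suc i..n}" "set bs = {1..i}"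
      using sets by (auto dest: separable_arrangementsD(1))
    moreover from this ne have "as \<noteq> []" "bs \<noteq> []"
      by auto
    ultimately show ?thesis
      using less \<open>iar as = k\<close> \<open>\<not> sum_decomposable (>) as\<close>
      by (intro first_block_pairsI) simp_all
  qed
  then show "z \<in> first_block_pairs n k" by (simp add: z)
qed

text \<open>For fixed \<open>i\<close> both alternatives leave \<open>bs\<close> arbitrary. Up to
  shifts, their first blocks together are all separable permutations of size \<open>n - i\<close>
  with run \<open>k\<close>, each exactly once.\<close>

lemma card_first_block_pairs:
  "card (first_block_pairs n k) =
     (\<Sum>i=1..n-1. p (n - i) k * card (separable_permutations i))"
proof -
  define D where "D i = {as \<in> separable_arrangements {1..n-i}. iar as = k \<and> sum_decomposable (>) as} \<times>
       separable_arrangements {Suc (n-i)..n}" for i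
  define E where "E i = {as \<in> separable_arrangements {Suc i..n}. iar as = k \<and> \<not> sum_decomposable (>) as} \<times>
       separable_arrangements {1..i}" for i
  have fin: "finite (D i)" "finite (E i)" for i
    unfolding D_def E_def using finite_separable_arrangements by auto
  have len: "length (snd z) = i" if "i \<in> {1..n-1}" "z \<in> D i \<union> E i" for i z
    using that unfolding D_def E_def by (auto dest!: separable_arrangementsD(5))
  have card: "card (D i \<union> E i) = p (n - i) k * card (separable_permutations i)"
    if i: "i \<in> {1..n-1}" for i
  proof -
    have eq: "(n - i) + i = n" "i + (n - i) = n" using i by auto
    have all: "card (separable_arrangements {Suc (n-i)..n}) = card (separable_permutations i)"
      using card_separable_arrangements_shift[of "\<lambda>_. True" "n - i" i] by (simp add: eq)
    have skew: "card {as \<in> separable_arrangements {Suc i..n}. iar as = k \<and> \<not> sum_decomposable (>) as} =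
        card {as \<in> separable_permutations (n - i). iar as = k \<and> \<not> sum_decomposable (>) as}"
      using card_separable_arrangements_shift[of "\<lambda>as. iar as = k \<and> \<not> sum_decomposable (>) as" i "n - i"]
      by (simp add: eq iar_shift skew_decomposable_shift)
    have "D i \<inter> E i = {}" unfolding D_def E_def by auto
    then have "card (D i \<union> E i) = card (D i) + card (E i)"
      using fin by (simp add: card_Un_disjoint)
    also have "\<dots> = (card {as \<in> separable_permutations (n - i). iar as = k \<and> sum_decomposable (>) as}
        + card {as \<in> separable_permutations (n - i). iar as = k \<and> \<not> sum_decomposable (>) as})
        * card (separable_permutations i)"
      unfolding D_def E_def card_cartesian_product all skew separable_permutations_eq[symmetric]
      by (simp add: distrib_right)
    also have "card {as \<in> separable_permutations (n - i). iar as = k \<and> sum_decomposable (>) as}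
        + card {as \<in> separable_permutations (n - i). iar as = k \<and> \<not> sum_decomposable (>) as}
        = card ({as \<in> separable_permutations (n - i). iar as = k \<and> sum_decomposable (>) as} \<union>
           {as \<in> separable_permutations (n - i). iar as = k \<and> \<not> sum_decomposable (>) as})"
      by (rule card_Un_disjoint[symmetric])
        (auto simp: separable_permutations_eq finite_separable_arrangements)
    also have "\<dots> = p (n - i) k"
      unfolding p_def by (rule arg_cong[of _ _ card]) auto
    finally show ?thesis .
  qed
  have "card (first_block_pairs n k) = card (\<Union>i\<in>{1..n-1}. D i \<union> E i)"
    unfolding first_block_pairs_eq D_def E_def ..
  also have "\<dots> = (\<Sum>i=1..n-1. card (D i \<union> E i))"
  proof (rule card_UN_disjoint)
    show "\<forall>i\<in>{1..n-1}. \<forall>j\<in>{1..n-1}. i \<noteq> j \<longrightarrow> (D i \<union> E i) \<inter> (D j \<union> E j) = {}"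
      using len by blast
  qed (use fin in auto)
  also have "\<dots> = (\<Sum>i=1..n-1. p (n - i) k * card (separable_permutations i))"
    using card by (rule sum.cong[OF refl])
  finally show ?thesis .
qed

section \<open>Initial values and the convolution recurrence for permutations\<close>

lemma separable_permutations_1: "separable_permutations 1 = {[1]}"
proof -
  have "avoids_2413 lt [1]" for lt :: "nat \<Rightarrow> nat \<Rightarrow> bool"
    by (auto simp: avoids_2413_def dest: list_emb_length)
  then show ?thesis
    by (auto simp: separable_permutations_eq separable_arrangements_def)
qed

text \<open>Deleting the leading 1 shortens the run by one. For \<open>n\<close> at least 2 the
  remaining list is nonempty, as \<open>iar\<close> requires.\<close>

lemma card_hd_1:
  assumes "2 \<le> n"
  shows "card {xs \<in> separable_permutations n. iar xs = Suc k \<and> hd xs = 1} = p (n - 1) k"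
proof -
  have "{1..n} = {1} \<union> {Suc 1..n}" using assms by auto
  have "{xs \<in> separable_permutations n. iar xs = Suc k \<and> hd xs = 1} =
    (#) 1 ` {xs \<in> separable_arrangements {Suc 1..n}. iar xs = k}"
  proof (intro equalityI subsetI)
    fix xs assume "xs \<in> {xs \<in> separable_permutations n. iar xs = Suc k \<and> hd xs = 1}"
    then have xs: "xs \<in> separable_arrangements {1..n}" "iar xs = Suc k" "hd xs = 1"
      by (auto simp: separable_permutations_eq)
    note D = separable_arrangementsD[OF xs(1)]
    have "xs \<noteq> []" using D(1) assms by auto
    with xs(3) obtain ys where ys: "xs = [1] @ ys" by (cases xs) auto
    with D(1,2) have "set [1] \<union> set ys = {1..n}" "1 \<notin> set ys" by auto
    then have "set ys = {1..n} - {1}" by auto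
    also have "\<dots> = {Suc 1..n}" by auto
    finally have set: "set ys = {Suc 1..n}" .
    then have ys_sep: "ys \<in> separable_arrangements {Suc 1..n}"
      using separable_arrangements_split(2) xs(1) ys by metis
    have "ys \<noteq> []" using set assms by auto
    moreover have "\<forall>y\<in>set ys. 1 < y" using set by auto
    ultimately have "iar ys = k" using iar_Cons[of ys 1] xs(2) ys by simp
    with ys_sep ys show "xs \<in> (#) 1 ` {xs \<in> separable_arrangements {Suc 1..n}. iar xs = k}"
      by simp
  next
    fix xs assume "xs \<in> (#) 1 ` {xs \<in> separable_arrangements {Suc 1..n}. iar xs = k}"
    then obtain ys where ys: "xs = 1 # ys" "ys \<in> separable_arrangements {Suc 1..n}" "iar ys = k"
      by blast
    have "[1] \<in> separable_arrangements {1}"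
      using separable_permutations_1 by (simp add: separable_permutations_eq)
    from separable_arrangements_append[OF this ys(2)] have "xs \<in> separable_arrangements {1..n}"
      unfolding \<open>{1..n} = _\<close> ys(1) by auto
    moreover have set: "set ys = {Suc 1..n}" using separable_arrangementsD(1)[OF ys(2)] .
    have "ys \<noteq> []" using set assms by auto
    moreover have "\<forall>y\<in>set ys. 1 < y" using set by auto
    ultimately show "xs \<in> {xs \<in> separable_permutations n. iar xs = Suc k \<and> hd xs = 1}"
      using iar_Cons[of ys 1] ys by (simp add: separable_permutations_eq)
  qed
  then have "card {xs \<in> separable_permutations n. iar xs = Suc k \<and> hd xs = 1} =
      card {xs \<in> separable_arrangements {Suc 1..n}. iar xs = k}"
    by (simp add: card_image)
  also have "\<dots> = p (n - 1) k"
    using card_separable_arrangements_shift[of "\<lambda>xs. iar xs = k" 1 "n - 1"] assms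
    by (simp add: iar_shift p_def)
  finally show ?thesis .
qed

lemma separable_permutations_nonempty_list:
  "1 \<le> n \<Longrightarrow> xs \<in> separable_permutations n \<Longrightarrow> xs \<noteq> [] \<and> length xs = n"
  using separable_arrangementsD(5)[of xs "{1..n}"] by (auto simp: separable_permutations_eq)

text \<open>The value at \<open>k = 0\<close> removes the first term of \<open>p_convolution\<close>
  for runs of length 1.\<close>

lemma p_eq_0:
  assumes "1 \<le> n" "k = 0 \<or> n < k"
  shows "p n k = 0"
proof -
  have "iar xs \<noteq> k" if "xs \<in> separable_permutations n" for xs
    using separable_permutations_nonempty_list[OF assms(1) that] iar_bounds[of xs] assms(2) by auto
  then have "{xs \<in> separable_permutations n. iar xs = k} = {}"
    by blast
  then show ?thesis
    unfolding p_def by (simp only: card.empty)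
qed

lemma p_1: "p 1 k = (if k = 1 then 1 else 0)"
proof (cases "k = 1")
  case True
  have "iar [1] = 1" using iar_bounds[of "[1]"] by simp
  then have "{xs \<in> separable_permutations 1. iar xs = 1} = {[1]}"
    unfolding separable_permutations_1 by auto
  then show ?thesis unfolding p_def True by simp
next
  case False
  then have "k = 0 \<or> 1 < k" by linarith
  then show ?thesis using p_eq_0[of 1 k] False by (simp only: le_refl if_False)
qed

lemma card_separable_permutations:
  assumes "1 \<le> n"
  shows "card (separable_permutations n) = (\<Sum>k=1..n. p n k)"
proof -
  have "separable_permutations n = (\<Union>k\<in>{1..n}. {xs \<in> separable_permutations n. iar xs = k})"
  proof (intro equalityI subsetI)
    fix xs assume xs: "xs \<in> separable_permutations n"
    with separable_permutations_nonempty_list[OF assms this] iar_bounds[of xs]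
    have "iar xs \<in> {1..n}" by auto
    with xs show "xs \<in> (\<Union>k\<in>{1..n}. {xs \<in> separable_permutations n. iar xs = k})"
      by blast
  qed blast
  also have "card \<dots> = (\<Sum>k=1..n. p n k)"
    unfolding p_def
    by (rule card_UN_disjoint) (auto simp: separable_permutations_eq finite_separable_arrangements)
  finally show ?thesis .
qed

lemma p_convolution:
  assumes "2 \<le> n"
  shows "p n (Suc k) = p (n - 1) k + (\<Sum>i=1..n-1. p (n - i) (Suc k) * card (separable_permutations i))"
proof -
  have "{xs \<in> separable_permutations n. iar xs = Suc k} =
      {xs \<in> separable_permutations n. iar xs = Suc k \<and> hd xs = 1} \<union>
      {xs \<in> separable_permutations n. iar xs = Suc k \<and> hd xs \<noteq> 1}" (is "_ = ?A \<union> ?B")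
    by auto
  moreover have "card (?A \<union> ?B) = card ?A + card ?B"
    by (rule card_Un_disjoint) (auto simp: separable_permutations_eq finite_separable_arrangements)
  moreover have "card ?B = card (first_block_pairs n (Suc k))"
    using card_image[OF inj_on_append_first_block_pairs, of n "Suc k"]
      append_image_first_block_pairs[of n "Suc k"] assms by simp
  ultimately show ?thesis
    unfolding p_def[of n] using card_hd_1[OF assms, of k] card_first_block_pairs[of n "Suc k"]
    by simp
qed

section \<open>First returns and hills of Schroeder paths\<close>

abbreviation height :: "step list \<Rightarrow> int" where
  "height w \<equiv> snd (endpoint w)"

text \<open>Prefixes replace the indices of \<open>schroeder_paths\<close> because they behave well
  under concatenation.\<close>

definition nonneg_path :: "step list \<Rightarrow> bool" where
  "nonneg_path w \<longleftrightarrow> (\<forall>u. prefix u w \<longrightarrow> 0 \<le> height u)"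

lemma endpoint_simps [simp]:
  "endpoint [] = 0" "endpoint (s # w) = step_vector s + endpoint w"
  "endpoint (u @ v) = endpoint u + endpoint v"
  by (simp_all add: endpoint_def)

lemma schroeder_paths_eq: "schroeder_paths m = {w. endpoint w = (2 * int m, 0) \<and> nonneg_path w}"
proof -
  have "(\<forall>i\<le>length w. 0 \<le> height (take i w)) \<longleftrightarrow> nonneg_path w" for w
  proof
    assume *: "\<forall>i\<le>length w. 0 \<le> height (take i w)"
    show "nonneg_path w"
      unfolding nonneg_path_def
    proof (intro allI impI)
      fix u assume "prefix u w"
      then have "u = take (length u) w" "length u \<le> length w"
        by (auto simp: prefix_def)
      with * show "0 \<le> height u" by metis
    qed
  qed (simp add: nonneg_path_def take_is_prefix)
  then show ?thesis
    unfolding schroeder_paths_def by simp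
qed

lemma length_le_width: "int (length w) \<le> fst (endpoint w)"
proof (induction w)
  case (Cons s w)
  then show ?case by (cases s) simp_all
qed simp

lemma finite_schroeder_paths: "finite (schroeder_paths m)"
proof (rule finite_subset)
  show "schroeder_paths m \<subseteq> {w. set w \<subseteq> {Up, Down, Horizontal} \<and> length w \<le> 2 * m}"
  proof
    fix w assume "w \<in> schroeder_paths m"
    then have "length w \<le> 2 * m"
      using length_le_width[of w] by (simp add: schroeder_paths_eq)
    moreover have "set w \<subseteq> {Up, Down, Horizontal}"
      using step.exhaust by blast
    ultimately show "w \<in> {w. set w \<subseteq> {Up, Down, Horizontal} \<and> length w \<le> 2 * m}"
      by simp
  qed
qed (rule finite_lists_length_le, simp)

text \<open>Each single step has even coordinate sum. Thus a factor that ends on its starting level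
  has even width, hence an integral semilength.\<close>

lemma even_width_plus_height: "even (fst (endpoint w) + snd (endpoint w))"
proof (induction w)
  case (Cons s w)
  then show ?case by (cases s) simp_all
qed simp

lemma nonneg_path_simps [simp]:
  "nonneg_path []" "\<not> nonneg_path (Down # w)"
  "nonneg_path (Horizontal # w) \<longleftrightarrow> nonneg_path w"
  by (auto simp: nonneg_path_def prefix_Cons intro: exI[of _ "[Down]"])

lemma nonneg_path_first_return:
  assumes "nonneg_path u" "height u = 0"
  shows "nonneg_path (Up # u @ Down # v) \<longleftrightarrow> nonneg_path v"
proof
  assume *: "nonneg_path (Up # u @ Down # v)"
  show "nonneg_path v"
    unfolding nonneg_path_def
  proof (intro allI impI)
    fix x assume "prefix x v"
    then have "prefix (Up # u @ Down # x) (Up # u @ Down # v)"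
      by simp
    with * have "0 \<le> height (Up # u @ Down # x)"
      unfolding nonneg_path_def by blast
    with assms(2) show "0 \<le> height x" by simp
  qed
next
  assume *: "nonneg_path v"
  show "nonneg_path (Up # u @ Down # v)"
    unfolding nonneg_path_def
  proof (intro allI impI)
    fix x assume "prefix x (Up # u @ Down # v)"
    then consider "x = []" | y where "x = Up # y" "prefix y u"
      | y where "x = Up # u @ Down # y" "prefix y v" | "x = Up # u"
      by (auto simp: prefix_Cons prefix_append)
    then show "0 \<le> height x"
    proof cases
      case (2 y)
      then have "0 \<le> height y" using assms(1) by (simp add: nonneg_path_def)
      with 2 show ?thesis by simp
    next
      case (3 y)
      then have "0 \<le> height y" using * by (simp add: nonneg_path_def)
      with 3 assms(2) show ?thesis by simp
    qed (use assms(2) in simp_all)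
  qed
qed

text \<open>If one of the two factors were longer, it would continue after the shorter one with a
  down step from height 0.\<close>

lemma first_return_unique:
  assumes "u @ Down # v = u' @ Down # v'" "nonneg_path u" "nonneg_path u'"
    "height u = 0" "height u' = 0"
  shows "u = u'"
proof -
  have *: "x = []" if "y = z @ x" "nonneg_path y" "height z = 0" "x @ Down # v = Down # v'"
    for x y z v v'
  proof (rule ccontr)
    assume "x \<noteq> []"
    with that(4) obtain x' where "x = Down # x'" by (cases x) auto
    with that(1) have "prefix (z @ [Down]) y" by simp
    with that(2,3) show False by (auto simp: nonneg_path_def)
  qed
  from assms(1) obtain x where
    "u = u' @ x \<and> x @ Down # v = Down # v' \<or> u @ x = u' \<and> Down # v = x @ Down # v'"
    unfolding append_eq_append_conv2 by blast
  then show ?thesis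
  proof (elim disjE conjE)
    assume "u = u' @ x" "x @ Down # v = Down # v'"
    with *[of u u' x v v'] assms show ?thesis by simp
  next
    assume "u @ x = u'" "Down # v = x @ Down # v'"
    with *[of u' u x v' v] assms show ?thesis by simp
  qed
qed

text \<open>Without its initial up step the path ends at height -1. The shortest prefix of
  \<open>w\<close> below 0 is \<open>u\<close> followed by the returning down step.\<close>

lemma first_return_exists:
  assumes "nonneg_path (Up # w)" "height (Up # w) = 0"
  obtains u v where "w = u @ Down # v" "nonneg_path u" "height u = 0"
proof -
  define Q where "Q q \<longleftrightarrow> prefix q w \<and> height q < 0" for q
  have "Q w" using assms(2) by (simp add: Q_def)
  then obtain q where q: "Q q" "\<And>x. Q x \<Longrightarrow> length q \<le> length x"
    using ex_has_least_nat[of Q _ length] by blast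
  from q(1) have "q \<noteq> []" by (auto simp: Q_def)
  then obtain u s where us: "q = u @ [s]" by (cases q rule: rev_cases) auto
  have nonneg: "0 \<le> height x" if "prefix x u" for x
  proof (rule ccontr)
    assume "\<not> 0 \<le> height x"
    moreover have "prefix x w"
      using that q(1) us unfolding Q_def by (metis append_prefixD prefix_order.trans)
    ultimately have "Q x" by (simp add: Q_def)
    then have "length q \<le> length x" by (rule q(2))
    with us prefix_length_le[OF that] show False by simp
  qed
  then have "0 \<le> height u" by simp
  moreover have "height u + snd (step_vector s) < 0"
    using q(1) us by (simp add: Q_def)
  \<comment> \<open>Only a down step loses height, and it loses just 1, so \<open>u\<close> must end
    exactly on the axis.\<close>
  ultimately have "s = Down" "height u = 0"
    by (cases s; simp)+
  moreover obtain v where "w = q @ v" using q(1) by (auto simp: Q_def prefix_def)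
  ultimately have "w = u @ Down # v" using us by simp
  moreover have "nonneg_path u" using nonneg by (simp add: nonneg_path_def)
  ultimately show thesis using that \<open>height u = 0\<close> by blast
qed

text \<open>The first argument is the height at which the remaining path starts; it distinguishes
  hills from higher peaks during the recursion.\<close>

fun hill_count :: "int \<Rightarrow> step list \<Rightarrow> nat" where
  "hill_count c [] = 0"
| "hill_count c (s # w) =
     (if c = 0 \<and> s = Up \<and> w \<noteq> [] \<and> hd w = Down then 1 else 0) +
     hill_count (c + snd (step_vector s)) w"

lemma card_hill_positions:
  "card {i. Suc i < length w \<and> w ! i = Up \<and> w ! Suc i = Down \<and> c + height (take i w) = 0} =
     hill_count c w"
proof (induction w arbitrary: c)
  case (Cons s w)
  let ?P = "\<lambda>c w. {i. Suc i < length w \<and> w ! i = Up \<and> w ! Suc i = Down \<and> c + height (take i w) = 0}"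
  let ?Z = "if c = 0 \<and> s = Up \<and> w \<noteq> [] \<and> hd w = Down then {0} else {} :: nat set"
  have "?P c (s # w) = ?Z \<union> Suc ` ?P (c + snd (step_vector s)) w"
  proof (intro set_eqI)
    fix i
    show "i \<in> ?P c (s # w) \<longleftrightarrow> i \<in> ?Z \<union> Suc ` ?P (c + snd (step_vector s)) w"
      by (cases i) (auto simp: hd_conv_nth add.assoc)
  qed
  moreover have "finite (?P d w)" for d
    by (rule finite_subset[of _ "{..length w}"]) auto
  then have "card (?Z \<union> Suc ` ?P (c + snd (step_vector s)) w) =
      card ?Z + card (Suc ` ?P (c + snd (step_vector s)) w)"
    by (intro card_Un_disjoint) auto
  ultimately show ?case
    by (simp add: card_image Cons.IH)
qed simp

lemma hills_eq: "hills w = hill_count 0 w"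
  using card_hill_positions[of w 0] by (simp add: hills_def)

text \<open>Steps that start above the axis begin no hill, so \<open>u\<close> contributes nothing,
  not even at its junction with \<open>v\<close>.\<close>

lemma hill_count_elevated:
  assumes "\<And>x. prefix x u \<Longrightarrow> 0 < c + height x"
  shows "hill_count c (u @ v) = hill_count (c + height u) v"
  using assms
proof (induction u arbitrary: c)
  case (Cons s u)
  have "0 < c" using Cons.prems[of "[]"] by simp
  moreover have "0 < (c + snd (step_vector s)) + height x" if "prefix x u" for x
    using Cons.prems[of "s # x"] that by (simp add: add.assoc)
  ultimately show ?case
    using Cons.IH[of "c + snd (step_vector s)"] by (simp add: add.assoc)
qed simp

lemma hills_simps:
  "hills [] = 0" "hills (Horizontal # v) = hills v" "hills (Up # Down # v) = Suc (hills v)"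
  by (simp_all add: hills_eq)

text \<open>A nonempty nonnegative \<open>u\<close> does not begin with a down step, so the first up
  step starts no hill; all of \<open>u\<close> runs at height 1 or more.\<close>

lemma hills_first_return:
  assumes "nonneg_path u" "height u = 0" "u \<noteq> []"
  shows "hills (Up # u @ Down # v) = hills v"
proof -
  have "hd u \<noteq> Down" using assms(1,3) by (cases u) auto
  moreover have "0 < 1 + height x" if "prefix x u" for x
    using assms(1) that by (simp add: nonneg_path_def add_pos_nonneg)
  then have "hill_count 1 (u @ Down # v) = hill_count 1 (Down # v)"
    using hill_count_elevated[of u 1 "Down # v"] assms(2) by simp
  ultimately show ?thesis
    using assms(3) by (simp add: hills_eq)
qed

text \<open>A horizontal step on the axis is treated as the elevation of the empty path; the actual
  elevation \<open>UD\<close> of the empty path, a hill, is dealt with separately.\<close>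

definition elevate :: "step list \<Rightarrow> step list" where
  "elevate u = (if u = [] then [Horizontal] else Up # u @ [Down])"

lemma elevate_append:
  "elevate [] @ v = Horizontal # v" "u \<noteq> [] \<Longrightarrow> elevate u @ v = Up # u @ Down # v"
  by (simp_all add: elevate_def)

lemma hills_elevate_append: "u \<in> schroeder_paths i \<Longrightarrow> hills (elevate u @ v) = hills v"
  by (cases "u = []")
    (simp_all add: elevate_append hills_simps hills_first_return schroeder_paths_eq)

lemma schroeder_paths_elevate_append:
  assumes "u \<in> schroeder_paths i" "v \<in> schroeder_paths j"
  shows "elevate u @ v \<in> schroeder_paths (Suc (i + j))"
  using assms
  by (cases "u = []") (auto simp: elevate_append schroeder_paths_eq nonneg_path_first_return zero_prod_def)

lemma elevate_append_inject:
  assumes "u \<in> schroeder_paths i" "u' \<in> schroeder_paths i'" "elevate u @ v = elevate u' @ v'"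
  shows "u = u'" "v = v'"
proof -
  show "u = u'"
  proof (cases "u = [] \<or> u' = []")
    case True
    then show ?thesis
      using assms(3) by (cases "u = []"; cases "u' = []") (simp_all add: elevate_append)
  next
    case False
    then have "u @ Down # v = u' @ Down # v'"
      using assms(3) by (simp add: elevate_append)
    then show ?thesis
      by (rule first_return_unique) (use assms in \<open>simp_all add: schroeder_paths_eq\<close>)
  qed
  with assms(3) show "v = v'" by simp
qed

lemma schroeder_paths_Suc_cases:
  assumes "w \<in> schroeder_paths (Suc m)"
  obtains v where "w = Up # Down # v" "v \<in> schroeder_paths m"
    | i u v where "i \<le> m" "u \<in> schroeder_paths i" "v \<in> schroeder_paths (m - i)" "w = elevate u @ v"
proof -
  from assms have w: "endpoint w = (2 + 2 * int m, 0)" "nonneg_path w"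
    by (simp_all add: schroeder_paths_eq)
  from w(1) have "w \<noteq> []" by (auto simp: zero_prod_def)
  then obtain s x where "w = s # x" by (cases w) auto
  then consider "w = Up # x" | "w = Horizontal # x"
    using w(2) by (cases s) auto
  then show thesis
  proof cases
    case 1
    with w obtain u v where uv: "x = u @ Down # v" "nonneg_path u" "height u = 0"
      using first_return_exists[of x] by auto
    have "nonneg_path v"
      using nonneg_path_first_return[OF uv(2,3), of v] w(2) 1 uv(1) by simp
    have sum: "fst (endpoint u) + fst (endpoint v) = 2 * int m" "height v = 0"
      using w(1) 1 uv by (simp_all add: prod_eq_iff)
    \<comment> \<open>Parity provides the semilength \<open>i\<close> of \<open>u\<close>; the
      nonnegative width of \<open>v\<close> then bounds it by \<open>m\<close>.\<close>
    have "even (fst (endpoint u))" "0 \<le> fst (endpoint u)" "0 \<le> fst (endpoint v)"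
      using even_width_plus_height[of u] uv(3) length_le_width[of u] length_le_width[of v] by auto
    then obtain i where i: "fst (endpoint u) = 2 * int i"
      by (metis evenE nonneg_int_cases zero_le_mult_iff zero_less_numeral not_less)
    with sum \<open>0 \<le> fst (endpoint v)\<close> have "i \<le> m" "fst (endpoint v) = 2 * int (m - i)"
      by auto
    have u: "u \<in> schroeder_paths i"
      using uv i by (simp add: schroeder_paths_eq prod_eq_iff)
    have v: "v \<in> schroeder_paths (m - i)"
      using sum(2) \<open>fst (endpoint v) = _\<close> \<open>nonneg_path v\<close>
      by (simp add: schroeder_paths_eq prod_eq_iff)
    show thesis
    proof (cases "u = []")
      case True
      then have "i = 0" using i by simp
      with True show thesis using that(1)[of v] v 1 uv(1) by simp
    next
      case False
      then show thesis
        using that(2)[OF \<open>i \<le> m\<close> u v] 1 uv(1) by (simp add: elevate_append)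
    qed
  next
    case 2
    then have "x \<in> schroeder_paths (m - 0)"
      using w by (simp add: schroeder_paths_eq prod_eq_iff)
    moreover have "[] \<in> schroeder_paths 0"
      by (simp add: schroeder_paths_eq zero_prod_def)
    ultimately show thesis
      using that(2)[of 0 "[]" x] 2 by (simp add: elevate_append)
  qed
qed

lemma schroeder_paths_0: "schroeder_paths 0 = {[]}"
proof -
  have "w = []" if "w \<in> schroeder_paths 0" for w
    using length_le_width[of w] that by (simp add: schroeder_paths_eq)
  then show ?thesis
    by (auto simp: schroeder_paths_eq zero_prod_def)
qed

section \<open>Convolution recurrence for paths by hills\<close>

lemma r_0: "r 0 l = (if l = 0 then 1 else 0)"
proof -
  have "{w \<in> schroeder_paths 0. hills w = l} = (if l = 0 then {[]} else {})"
    by (auto simp: schroeder_paths_0 hills_simps)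
  then show ?thesis by (simp add: r_def)
qed

lemma card_hill_first:
  "card {w \<in> schroeder_paths (Suc m). hills w = l \<and> (\<exists>v. w = Up # Down # v)} =
     (if l = 0 then 0 else r m (l - 1))"
proof -
  have path: "Up # Down # v \<in> schroeder_paths (Suc m) \<longleftrightarrow> v \<in> schroeder_paths m" for v
    using nonneg_path_first_return[of "[]" v] by (auto simp: schroeder_paths_eq prod_eq_iff)
  have "{w \<in> schroeder_paths (Suc m). hills w = l \<and> (\<exists>v. w = Up # Down # v)} =
      (\<lambda>v. Up # Down # v) ` {v \<in> schroeder_paths m. Suc (hills v) = l}"
    by (auto simp: path hills_simps)
  also have "card \<dots> = card {v \<in> schroeder_paths m. Suc (hills v) = l}"
    by (rule card_image) (simp add: inj_on_def)
  also have "\<dots> = (if l = 0 then 0 else r m (l - 1))"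
    by (cases l) (simp_all add: r_def)
  finally show ?thesis .
qed

text \<open>These paths are exactly the \<open>elevate u @ v\<close>, with \<open>(u, v)\<close>
  uniquely determined, and all their hills lie in \<open>v\<close>.\<close>

lemma card_not_hill_first:
  "card {w \<in> schroeder_paths (Suc m). hills w = l \<and> \<not> (\<exists>v. w = Up # Down # v)} =
     (\<Sum>i\<le>m. card (schroeder_paths i) * r (m - i) l)"
proof -
  define F :: "step list \<times> step list \<Rightarrow> step list" where "F = (\<lambda>(u, v). elevate u @ v)"
  define S where "S i = schroeder_paths i \<times> {v \<in> schroeder_paths (m - i). hills v = l}" for i
  have not_hill: "elevate u @ v \<noteq> Up # Down # v'" if "u \<in> schroeder_paths i" for i u v v'
  proof (cases u)
    case (Cons s x)
    with that have "s \<noteq> Down" by (auto simp: schroeder_paths_eq)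
    with Cons show ?thesis by (simp add: elevate_def)
  qed (simp add: elevate_def)
  have "{w \<in> schroeder_paths (Suc m). hills w = l \<and> \<not> (\<exists>v. w = Up # Down # v)} =
      F ` (\<Union>i\<le>m. S i)"
  proof (intro equalityI subsetI)
    fix w assume w: "w \<in> {w \<in> schroeder_paths (Suc m). hills w = l \<and> \<not> (\<exists>v. w = Up # Down # v)}"
    then have "w \<in> schroeder_paths (Suc m)" by simp
    then show "w \<in> F ` (\<Union>i\<le>m. S i)"
    proof (cases rule: schroeder_paths_Suc_cases)
      case (1 v)
      with w show ?thesis by simp
    next
      case (2 i u v)
      with w hills_elevate_append[of u i v] have "(u, v) \<in> S i"
        by (simp add: S_def)
      with 2 show ?thesis
        by (intro image_eqI[of _ _ "(u, v)"]) (auto simp: F_def)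
    qed
  next
    fix w assume "w \<in> F ` (\<Union>i\<le>m. S i)"
    then obtain i u v where *: "i \<le> m" "u \<in> schroeder_paths i" "v \<in> schroeder_paths (m - i)"
      "hills v = l" "w = elevate u @ v"
      by (auto simp: F_def S_def)
    then show "w \<in> {w \<in> schroeder_paths (Suc m). hills w = l \<and> \<not> (\<exists>v. w = Up # Down # v)}"
      using schroeder_paths_elevate_append[of u i v "m - i"] hills_elevate_append[of u i v]
        not_hill[of u i v] by simp
  qed
  also have "card (F ` (\<Union>i\<le>m. S i)) = card (\<Union>i\<le>m. S i)"
  proof (rule card_image, intro inj_onI)
    fix x y assume "x \<in> (\<Union>i\<le>m. S i)" "y \<in> (\<Union>i\<le>m. S i)" "F x = F y"
    then obtain i j u v u' v' where "u \<in> schroeder_paths i" "u' \<in> schroeder_paths j"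
      "elevate u @ v = elevate u' @ v'" "x = (u, v)" "y = (u', v')"
      by (auto simp: F_def S_def)
    then show "x = y" using elevate_append_inject by metis
  qed
  also have "\<dots> = (\<Sum>i\<le>m. card (S i))"
  proof (rule card_UN_disjoint)
    show "\<forall>i\<in>{..m}. finite (S i)"
      by (simp add: S_def finite_schroeder_paths)
    \<comment> \<open>The endpoint of the first component determines \<open>i\<close>.\<close>
    show "\<forall>i\<in>{..m}. \<forall>j\<in>{..m}. i \<noteq> j \<longrightarrow> S i \<inter> S j = {}"
      by (auto simp: S_def schroeder_paths_eq)
  qed simp
  also have "\<dots> = (\<Sum>i\<le>m. card (schroeder_paths i) * r (m - i) l)"
    by (simp add: S_def card_cartesian_product r_def)
  finally show ?thesis .
qed

lemma r_convolution:
  "r (Suc m) l = (if l = 0 then 0 else r m (l - 1)) +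
     (\<Sum>i\<le>m. card (schroeder_paths i) * r (m - i) l)"
proof -
  let ?A = "{w \<in> schroeder_paths (Suc m). hills w = l \<and> (\<exists>v. w = Up # Down # v)}"
  let ?B = "{w \<in> schroeder_paths (Suc m). hills w = l \<and> \<not> (\<exists>v. w = Up # Down # v)}"
  have "r (Suc m) l = card (?A \<union> ?B)"
    unfolding r_def by (rule arg_cong[of _ _ card]) blast
  also have "\<dots> = card ?A + card ?B"
    by (rule card_Un_disjoint) (auto simp: finite_schroeder_paths)
  finally show ?thesis
    by (simp only: card_hill_first card_not_hill_first)
qed

text \<open>Follows from the convolution by induction; the bound on the hills of a single path is
  then deduced from it in \<open>card_schroeder_paths\<close>.\<close>

lemma r_eq_0: "m < l \<Longrightarrow> r m l = 0"
proof (induction m arbitrary: l rule: less_induct)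
  case (less m)
  show ?case
  proof (cases m)
    case 0
    with less show ?thesis by (simp add: r_0)
  next
    case (Suc n)
    with less show ?thesis by (simp add: r_convolution)
  qed
qed

lemma card_schroeder_paths: "card (schroeder_paths m) = (\<Sum>l\<le>m. r m l)"
proof -
  have "hills w \<le> m" if "w \<in> schroeder_paths m" for w
  proof (rule ccontr)
    assume "\<not> hills w \<le> m"
    then have "{v \<in> schroeder_paths m. hills v = hills w} = {}"
      using r_eq_0[of m "hills w"] finite_schroeder_paths[of m] by (simp add: r_def)
    with that show False by blast
  qed
  then have "schroeder_paths m = (\<Union>l\<le>m. {w \<in> schroeder_paths m. hills w = l})"
    by blast
  also have "card \<dots> = (\<Sum>l\<le>m. r m l)"
    unfolding r_def by (rule card_UN_disjoint) (auto simp: finite_schroeder_paths)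
  finally show ?thesis .
qed

section \<open>The recurrence with powers of 2\<close>

lemma sum_r: "m \<le> n \<Longrightarrow> (\<Sum>l\<le>n. r m l) = card (schroeder_paths m)"
  unfolding card_schroeder_paths by (rule sum.mono_neutral_right) (auto simp: r_eq_0)

text \<open>Summation of \<open>r_convolution\<close> over all \<open>l\<close>. The range up to
  \<open>Suc m\<close> covers every possible hill number of the shorter factors too.\<close>

lemma card_schroeder_paths_Suc:
  "card (schroeder_paths (Suc m)) = card (schroeder_paths m) +
     (\<Sum>i\<le>m. card (schroeder_paths i) * card (schroeder_paths (m - i)))"
proof -
  have "card (schroeder_paths (Suc m)) =
      (\<Sum>l\<le>Suc m. if l = 0 then 0 else r m (l - 1)) +
      (\<Sum>l\<le>Suc m. \<Sum>i\<le>m. card (schroeder_paths i) * r (m - i) l)"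
    unfolding card_schroeder_paths[of "Suc m"] r_convolution by (rule sum.distrib)
  also have "(\<Sum>l\<le>Suc m. if l = 0 then 0 else r m (l - 1)) = card (schroeder_paths m)"
    unfolding sum.atMost_Suc_shift by (simp add: card_schroeder_paths)
  also have "(\<Sum>l\<le>Suc m. \<Sum>i\<le>m. card (schroeder_paths i) * r (m - i) l) =
      (\<Sum>i\<le>m. card (schroeder_paths i) * (\<Sum>l\<le>Suc m. r (m - i) l))"
    unfolding sum_distrib_left by (rule sum.swap)
  also have "\<dots> = (\<Sum>i\<le>m. card (schroeder_paths i) * card (schroeder_paths (m - i)))"
    by (intro sum.cong refl) (simp only: sum_r[of _ "Suc m"] diff_le_self le_SucI)
  finally show ?thesis .
qed

section \<open>Generating functions\<close>

definition hill_fps :: "nat \<Rightarrow> int fps" where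
  "hill_fps l = Abs_fps (\<lambda>m. int (r m l))"

definition path_fps :: "int fps" where
  "path_fps = Abs_fps (\<lambda>m. int (card (schroeder_paths m)))"

lemma fps_nth_hill_fps: "fps_nth (hill_fps l) m = int (r m l)"
  by (simp add: hill_fps_def)

lemma fps_nth_path_fps: "fps_nth path_fps m = int (card (schroeder_paths m))"
  by (simp add: path_fps_def)

lemma fps_nth_path_fps_mult:
  "fps_nth (path_fps * hill_fps l) n = int (\<Sum>i\<le>n. card (schroeder_paths i) * r (n - i) l)"
  by (simp add: fps_nth_path_fps fps_nth_hill_fps fps_mult_nth atLeast0AtMost)

lemma fps_nth_path_fps_square:
  "fps_nth (path_fps\<^sup>2) n =
     int (\<Sum>i\<le>n. card (schroeder_paths i) * card (schroeder_paths (n - i)))"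
  by (simp add: fps_nth_path_fps power2_eq_square fps_mult_nth atLeast0AtMost)

lemma path_fps_eq: "path_fps = 1 + fps_X * path_fps + fps_X * path_fps\<^sup>2"
proof (rule fps_ext)
  fix n
  show "fps_nth path_fps n = fps_nth (1 + fps_X * path_fps + fps_X * path_fps\<^sup>2) n"
    by (cases n) (simp_all add: fps_nth_path_fps_square card_schroeder_paths_Suc
        schroeder_paths_0 fps_nth_path_fps)
qed

lemma hill_fps_0: "hill_fps 0 * (1 - fps_X * path_fps) = 1"
proof -
  have "hill_fps 0 = 1 + fps_X * (path_fps * hill_fps 0)"
  proof (rule fps_ext)
    fix n
    show "fps_nth (hill_fps 0) n = fps_nth (1 + fps_X * (path_fps * hill_fps 0)) n"
      by (cases n) (simp_all add: fps_nth_path_fps_mult fps_nth_hill_fps r_0 r_convolution)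
  qed
  then show ?thesis by (simp add: algebra_simps)
qed

lemma hill_fps_Suc: "hill_fps (Suc l) * (1 - fps_X * path_fps) = fps_X * hill_fps l"
proof -
  have "hill_fps (Suc l) = fps_X * hill_fps l + fps_X * (path_fps * hill_fps (Suc l))"
  proof (rule fps_ext)
    fix n
    show "fps_nth (hill_fps (Suc l)) n =
      fps_nth (fps_X * hill_fps l + fps_X * (path_fps * hill_fps (Suc l))) n"
      by (cases n) (simp_all add: fps_nth_path_fps_mult fps_nth_hill_fps r_0 r_convolution)
  qed
  then show ?thesis by (simp add: algebra_simps)
qed

text \<open>After multiplication by \<open>d\<^sup>2\<close> for \<open>d = 1 - X B\<close>, the case \<open>l = 0\<close> becomes \<open>(1 + X) d = 2 X + d\<^sup>2\<close>,
  which is the functional equation of \<open>B\<close>.\<close>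

lemma hill_fps_local:
  "(1 + fps_X) * hill_fps l = 2 * hill_fps (Suc l) + (if l = 0 then 1 else fps_X * hill_fps (l - 1))"
proof -
  define d :: "int fps" where "d = 1 - fps_X * path_fps"
  \<comment> \<open>Power series over the integers form an integral domain, so a nonzero
    \<open>d\<close> may be cancelled below.\<close>
  have "fps_nth d 0 = 1" by (simp add: d_def)
  then have "d \<noteq> 0" by auto
  have d: "(1 + fps_X) * d = 2 * fps_X + d\<^sup>2"
  proof -
    have "2 * fps_X + d\<^sup>2 - (1 + fps_X) * d =
        fps_X * (1 + fps_X * path_fps + fps_X * path_fps\<^sup>2 - path_fps)"
      by (simp add: d_def power2_eq_square algebra_simps)
    also have "\<dots> = 0"
      using path_fps_eq by simp
    finally show ?thesis by simp
  qed
  note rec = hill_fps_0[folded d_def] hill_fps_Suc[folded d_def]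
  show ?thesis
  proof (induction l)
    case 0
    have "((1 + fps_X) * hill_fps 0) * d\<^sup>2 = (1 + fps_X) * d * (hill_fps 0 * d)"
      by (simp add: power2_eq_square)
    also have "\<dots> = 2 * fps_X * (hill_fps 0 * d) + d\<^sup>2"
      by (simp add: rec d)
    also have "\<dots> = 2 * (hill_fps (Suc 0) * d) * d + d\<^sup>2"
      unfolding rec(2) by (simp add: rec(1) mult_ac)
    also have "\<dots> = (2 * hill_fps (Suc 0) + 1) * d\<^sup>2"
      by (simp only: distrib_right power2_eq_square mult.assoc mult_1)
    finally show ?case
      using \<open>d \<noteq> 0\<close> by simp
  next
    case (Suc l)
    \<comment> \<open>Multiplication by \<open>d\<close> lowers the index by one, which brings the
      induction hypothesis into play.\<close>
    have "((1 + fps_X) * hill_fps (Suc l)) * d = fps_X * ((1 + fps_X) * hill_fps l)"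
      unfolding mult.assoc rec(2) by (simp only: mult_ac)
    also have "\<dots> = 2 * (fps_X * hill_fps (Suc l)) +
        fps_X * (if l = 0 then 1 else fps_X * hill_fps (l - 1))"
      unfolding Suc.IH by (simp add: algebra_simps)
    \<comment> \<open>The two recursions for \<open>hill_fps\<close> have exactly this common form,
      so the case distinction disappears.\<close>
    also have "(if l = 0 then 1 else fps_X * hill_fps (l - 1)) = hill_fps l * d"
      by (cases l) (simp_all add: rec)
    also have "2 * (fps_X * hill_fps (Suc l)) + fps_X * (hill_fps l * d) =
        (2 * hill_fps (Suc (Suc l)) + fps_X * hill_fps l) * d"
      unfolding rec(2)[of "Suc l", symmetric] by (simp only: distrib_right mult.assoc)
    finally show ?case
      using \<open>d \<noteq> 0\<close> by simp
  qed
qed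

text \<open>Comparison of the coefficients of degree \<open>Suc m\<close> in
  \<open>hill_fps_local\<close>; the constant 1 occurring for \<open>l = 0\<close> has no such
  coefficient.\<close>

lemma r_local: "r (Suc m) l + r m l = 2 * r (Suc m) (Suc l) + (if l = 0 then 0 else r m (l - 1))"
proof -
  have two: "fps_nth (2 * f) k = 2 * fps_nth f k" for f :: "int fps" and k
    by (simp only: mult_2 fps_add_nth)
  have "fps_nth ((1 + fps_X) * hill_fps l) (Suc m) =
      fps_nth (2 * hill_fps (Suc l) + (if l = 0 then 1 else fps_X * hill_fps (l - 1))) (Suc m)"
    by (simp only: hill_fps_local)
  then have "int (r (Suc m) l + r m l) =
      int (2 * r (Suc m) (Suc l) + (if l = 0 then 0 else r m (l - 1)))"
    by (cases l) (simp_all add: two distrib_right fps_nth_hill_fps)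
  then show ?thesis
    by (simp only: of_nat_eq_iff)
qed

text \<open>Downward induction from \<open>l = Suc m\<close>. The weighted tail at \<open>l\<close>
  is \<open>r m l\<close> plus twice the tail at \<open>Suc l\<close>; doubling the induction
  hypothesis in \<open>r_local\<close> leaves one surplus \<open>r m l\<close>, which supplies that
  term.\<close>

lemma r_recurrence:
  assumes "l \<le> Suc m"
  shows "r (Suc m) l = (if l = 0 then 0 else r m (l - 1)) + (\<Sum>j=l..m. 2 ^ (j - l) * r m j)"
  using assms
proof (induction l rule: inc_induct)
  case base
  show ?case
    using r_local[of m "Suc m"] by (simp add: r_eq_0)
next
  case (step l)
  then have "l \<le> m" by simp
  have "(\<Sum>j=l..m. 2 ^ (j - l) * r m j) = r m l + (\<Sum>j=Suc l..m. 2 ^ (j - l) * r m j)"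
    using \<open>l \<le> m\<close> by (simp add: sum.atLeast_Suc_atMost)
  also have "(\<Sum>j=Suc l..m. 2 ^ (j - l) * r m j) = 2 * (\<Sum>j=Suc l..m. 2 ^ (j - Suc l) * r m j)"
    unfolding sum_distrib_left
  proof (rule sum.cong[OF refl])
    fix j assume "j \<in> {Suc l..m}"
    then have "j - l = Suc (j - Suc l)" by auto
    then show "2 ^ (j - l) * r m j = 2 * (2 ^ (j - Suc l) * r m j)" by simp
  qed
  finally show ?case
    using r_local[of m l] step.IH by simp
qed

text \<open>Both sides obey the same convolution after both indices are lowered by one. The
  induction is strong because all smaller sizes occur, and summing its hypothesis over
  \<open>l\<close> identifies the total counts that serve as coefficients.\<close>

lemma p_eq_r: "p (Suc m) (Suc l) = r m l"
proof (induction m arbitrary: l rule: less_induct)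
  case (less m)
  show ?case
  proof (cases m)
    case 0
    then show ?thesis using p_1[of "Suc l"] by (simp add: r_0)
  next
    case (Suc n)
    have card: "card (separable_permutations (Suc i)) = card (schroeder_paths i)" if "i < m" for i
    proof -
      have "card (separable_permutations (Suc i)) = (\<Sum>l=0..i. p (Suc i) (Suc l))"
        using card_separable_permutations[of "Suc i"] by (simp only: le_add1 One_nat_def
            sum.shift_bounds_cl_Suc_ivl Suc_le_mono le0)
      then show ?thesis
        using less[OF that] by (simp add: card_schroeder_paths atLeast0AtMost)
    qed
    have "p (Suc m) (Suc l) = p m l +
        (\<Sum>i=Suc 0..Suc n. p (Suc m - i) (Suc l) * card (separable_permutations i))"
      using p_convolution[of "Suc m" l] Suc by simp
    also have "p m l = (if l = 0 then 0 else r n (l - 1))"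
      using p_eq_0[of m l] less[of n "l - 1"] Suc by (cases l) simp_all
    also have "(\<Sum>i=Suc 0..Suc n. p (Suc m - i) (Suc l) * card (separable_permutations i)) =
        (\<Sum>i=0..n. p (Suc m - Suc i) (Suc l) * card (separable_permutations (Suc i)))"
      by (rule sum.shift_bounds_cl_Suc_ivl)
    also have "\<dots> = (\<Sum>i\<le>n. card (schroeder_paths i) * r (n - i) l)"
      unfolding atLeast0AtMost
    proof (rule sum.cong[OF refl])
      fix i assume "i \<in> {..n}"
      then have "Suc m - Suc i = Suc (n - i)" "n - i < m" "i < m" using Suc by auto
      then show "p (Suc m - Suc i) (Suc l) * card (separable_permutations (Suc i)) =
          card (schroeder_paths i) * r (n - i) l"
        using less[of "n - i" l] card[of i] by simp
    qed
    finally show ?thesis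
      unfolding Suc r_convolution .
  qed
qed

theorem theorem3p2:
  shows "p 1 1 = 1 \<and>
    (\<forall>n::nat. 2 \<le> n \<longrightarrow> p n 1 = (\<Sum>j = 1..n - 1. 2 ^ (j - 1) * p (n - 1) j)) \<and>
    (\<forall>(n::nat) (k::nat). 2 \<le> k \<and> k \<le> n \<longrightarrow>
       p n k = p (n - 1) (k - 1) + (\<Sum>j = k..n - 1. 2 ^ (j - k) * p (n - 1) j)) \<and>
    (\<forall>(n::nat) (k::nat). 1 \<le> k \<and> k \<le> n \<longrightarrow> r (n - 1) (k - 1) = p n k)"
proof -
  \<comment> \<open>The weighted recurrence is known for paths only and is carried over by
    \<open>p_eq_r\<close>; the summation index moves up by one, which leaves the exponents of 2
    unchanged.\<close>
  have rec: "p (Suc (Suc m)) (Suc l) = (if l = 0 then 0 else p (Suc m) l) +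
      (\<Sum>j=Suc l..Suc m. 2 ^ (j - Suc l) * p (Suc m) j)" if "l \<le> Suc m" for m l
    using r_recurrence[OF that] by (cases l) (simp_all only: p_eq_r sum.shift_bounds_cl_Suc_ivl
        diff_Suc_Suc diff_Suc_1 if_True if_False nat.distinct refl)
  have "p n 1 = (\<Sum>j = 1..n - 1. 2 ^ (j - 1) * p (n - 1) j)" if "2 \<le> n" for n
  proof -
    from that obtain m where "n = Suc (Suc m)"
      by (metis One_nat_def Suc_1 Suc_le_D Suc_le_mono)
    then show ?thesis using rec[of 0 m] by simp
  qed
  moreover have "p n k = p (n - 1) (k - 1) + (\<Sum>j = k..n - 1. 2 ^ (j - k) * p (n - 1) j)"
    if "2 \<le> k \<and> k \<le> n" for n k
  proof -
    from that obtain l where "k = Suc (Suc l)"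
      by (metis One_nat_def Suc_1 Suc_le_D Suc_le_mono)
    moreover from this that obtain m where "n = Suc (Suc m)"
      by (metis Suc_le_D Suc_le_mono)
    ultimately show ?thesis using rec[of "Suc l" m] that by simp
  qed
  moreover have "r (n - 1) (k - 1) = p n k" if "1 \<le> k \<and> k \<le> n" for n k
    using p_eq_r[of "n - 1" "k - 1"] that by simp
  ultimately show ?thesis
    using p_1[of 1] by simp
qed

end
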